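(* Let $F=Z+W\mathbf j\in L^1(\mathbb T^d;\mathbb H^{s\times s})$ ($Z,W$ $\mathbb C_{\mathbf i}^{s\times s}$-valued), fix $\tau\in\{L,R,(S_L,S_R)\}$, and assume $T^{(\tau)}_{\boldsymbol n}(F)$ is Hermitian for all $\boldsymbol n\in\mathbb N^d$. Set $m_\tau=\operatorname{ess\,inf}_{\boldsymbol\theta\in\mathbb T^d}\lambda_{\min}(G_\tau(\boldsymbol\theta))$ and $M_\tau=\operatorname{ess\,sup}_{\boldsymbol\theta\in\mathbb T^d}\lambda_{\max}(G_\tau(\boldsymbol\theta))$. Then for every $\boldsymbol n\in\mathbb N^d$, all eigenvalues of $T^{(\tau)}_{\boldsymbol n}(F)$ lie in $[m_\tau,M_\tau]$.
   Context: $\mathbb H$ is the quaternion algebra with units $\mathbf i,\mathbf j,\mathbf k=\mathbf i\mathbf j$; $\mathbb C_{\mathbf i}=\operatorname{span}_{\mathbb R}\{1,\mathbf i\}\cong\mathbb C$. Eigenvalues of a quaternion matrix are right eigenvalues ($Ax=x\lambda$); for a Hermitian quaternion matrix they are real. $\mathbb T^d=[-\pi,\pi)^d$; $S_L\dot\cup S_R=\{1,\dots,d\}$ ordered partition; $\tau=L$ means $S_L=\{1,\dots,d\}$, $\tau=R$ means $S_R=\{1,\dots,d\}$. Sandwich Fourier coefficients $\widehat F^{(S_L,S_R)}(\boldsymbol k)=(2\pi)^{-d}\int e^{-\mathbf i\langle\boldsymbol k,\boldsymbol\theta\rangle_{S_L}}F(\boldsymbol\theta)e^{-\mathbf i\langle\boldsymbol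 k,\boldsymbol\theta\rangle_{S_R}}d\boldsymbol\theta$, $\langle\boldsymbol k,\boldsymbol\theta\rangle_S=\sum_{j\in S}k_j\theta_j$; $T^{(\tau)}_{\boldsymbol n}(F)=[\widehat F^{(\tau)}(\alpha-\beta)]_{\alpha,\beta\in\Lambda_{\boldsymbol n}}$, $\Lambda_{\boldsymbol n}=\prod_\ell\{0,\dots,n_\ell-1\}$ (lexicographic). With $r_{S_L}(\boldsymbol\theta)_j=-\theta_j$ for $j\in S_L$ and $\theta_j$ for $j\in S_R$, $G_{(S_L,S_R)}(\boldsymbol\theta)=\begin{pmatrix}Z(\boldsymbol\theta)&W(r_{S_L}(-\boldsymbol\theta))\\-\overline{W(r_{S_L}(\boldsymbol\theta))}&\overline{Z(-\boldsymbol\theta)}\end{pmatrix}\in\mathbb C^{2s\times2s}$ (bar = complex conjugation). *)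

theory Defs
  imports "HOL-Analysis.Analysis"
begin

text \<open>Quaternions are represented as pairs of complex numbers: (z, w) stands for
  z + w j, where complex numbers are identified with C_i = span{1, i}.
  Addition / zero / sums are the componentwise ones of the product type.\<close>

type_synonym quat = "complex \<times> complex"

definition qmult :: "quat \<Rightarrow> quat \<Rightarrow> quat" where
  "qmult p q = (fst p * fst q - snd p * cnj (snd q), fst p * snd q + snd p * cnj (fst q))"

definition qconj :: "quat \<Rightarrow> quat" where
  "qconj q = (cnj (fst q), - snd q)"

definition qofreal :: "real \<Rightarrow> quat" where
  "qofreal r = (complex_of_real r, 0)"

definition qexpi :: "real \<Rightarrow> quat" where
  "qexpi x = (cis x, 0)"

definition torus :: "(real^'d::finite) set" where
  "torus = {\<theta>. \<forall>j. - pi \<le> \<theta> $ j \<and> \<theta> $ j < pi}"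

definition pairS :: "'d set \<Rightarrow> ('d \<Rightarrow> int) \<Rightarrow> real^'d::finite \<Rightarrow> real" where
  "pairS S k \<theta> = (\<Sum>j\<in>S. real_of_int (k j) * \<theta> $ j)"

definition quatF :: "(real^'d \<Rightarrow> 'a \<Rightarrow> 'a \<Rightarrow> complex) \<Rightarrow> (real^'d \<Rightarrow> 'a \<Rightarrow> 'a \<Rightarrow> complex)
    \<Rightarrow> real^'d::finite \<Rightarrow> 'a \<Rightarrow> 'a \<Rightarrow> quat" where
  "quatF Z W \<theta> a b = (Z \<theta> a b, W \<theta> a b)"

definition sandwich_coeff :: "'d set \<Rightarrow> (real^'d::finite \<Rightarrow> 'a \<Rightarrow> 'a \<Rightarrow> quat) \<Rightarrow> ('d \<Rightarrow> int)
    \<Rightarrow> 'a \<Rightarrow> 'a \<Rightarrow> quat" where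
  "sandwich_coeff SL F k a b =
     (2 * pi) powr (- real CARD('d)) *\<^sub>R
       (LINT \<theta>:torus|lborel. qmult (qmult (qexpi (- pairS SL k \<theta>)) (F \<theta> a b))
                                         (qexpi (- pairS (- SL) k \<theta>)))"

definition Lambda :: "('d \<Rightarrow> nat) \<Rightarrow> ('d \<Rightarrow> nat) set" where
  "Lambda n = {\<alpha>. \<forall>j. \<alpha> j < n j}"

text \<open>Block Toeplitz matrix T_n(F), rows/columns indexed by Lambda n \<times> block index.
  (The ordering of the index set is irrelevant for the spectrum.)\<close>
definition toeplitz :: "'d set \<Rightarrow> (real^'d::finite \<Rightarrow> 'a \<Rightarrow> 'a \<Rightarrow> quat)
    \<Rightarrow> (('d \<Rightarrow> nat) \<times> 'a) \<Rightarrow> (('d \<Rightarrow> nat) \<times> 'a) \<Rightarrow> quat" where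
  "toeplitz SL F p q =
     sandwich_coeff SL F (\<lambda>j. int (fst p j) - int (fst q j)) (snd p) (snd q)"

definition toeplitz_index :: "('d \<Rightarrow> nat) \<Rightarrow> (('d \<Rightarrow> nat) \<times> 'a) set" where
  "toeplitz_index n = Lambda n \<times> UNIV"

definition qhermitian :: "'i set \<Rightarrow> ('i \<Rightarrow> 'i \<Rightarrow> quat) \<Rightarrow> bool" where
  "qhermitian I A \<longleftrightarrow> (\<forall>p\<in>I. \<forall>q\<in>I. A q p = qconj (A p q))"

definition qright_eigenvalue :: "'i set \<Rightarrow> ('i \<Rightarrow> 'i \<Rightarrow> quat) \<Rightarrow> quat \<Rightarrow> bool" where
  "qright_eigenvalue I A lam \<longleftrightarrow>
     (\<exists>x. (\<exists>p\<in>I. x p \<noteq> 0) \<and> (\<forall>p\<in>I. (\<Sum>q\<in>I. qmult (A p q) (x q)) = qmult (x p) lam))"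

definition real_eigenvalues :: "('i::finite \<Rightarrow> 'i \<Rightarrow> complex) \<Rightarrow> real set" where
  "real_eigenvalues G = {x. \<exists>v. (\<exists>i. v i \<noteq> 0) \<and> (\<forall>i. (\<Sum>j\<in>UNIV. G i j * v j) = complex_of_real x * v i)}"

definition lambda_min :: "('i::finite \<Rightarrow> 'i \<Rightarrow> complex) \<Rightarrow> ereal" where
  "lambda_min G = Inf (ereal ` real_eigenvalues G)"

definition lambda_max :: "('i::finite \<Rightarrow> 'i \<Rightarrow> complex) \<Rightarrow> ereal" where
  "lambda_max G = Sup (ereal ` real_eigenvalues G)"

definition reflS :: "'d set \<Rightarrow> real^'d::finite \<Rightarrow> real^'d" where
  "reflS SL \<theta> = (\<chi> j. if j \<in> SL then - (\<theta> $ j) else \<theta> $ j)"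

definition Gsym :: "'d set \<Rightarrow> (real^'d \<Rightarrow> 'a \<Rightarrow> 'a \<Rightarrow> complex) \<Rightarrow> (real^'d \<Rightarrow> 'a \<Rightarrow> 'a \<Rightarrow> complex)
    \<Rightarrow> real^'d::finite \<Rightarrow> 'a + 'a \<Rightarrow> 'a + 'a \<Rightarrow> complex" where
  "Gsym SL Z W \<theta> p q = (case (p, q) of
       (Inl a, Inl b) \<Rightarrow> Z \<theta> a b
     | (Inl a, Inr b) \<Rightarrow> W (reflS SL (- \<theta>)) a b
     | (Inr a, Inl b) \<Rightarrow> - cnj (W (reflS SL \<theta>) a b)
     | (Inr a, Inr b) \<Rightarrow> cnj (Z (- \<theta>) a b))"

definition essinf_torus :: "(real^'d::finite \<Rightarrow> ereal) \<Rightarrow> ereal" where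
  "essinf_torus f = Sup {c. AE \<theta> in lborel. \<theta> \<in> torus \<longrightarrow> c \<le> f \<theta>}"

definition esssup_torus :: "(real^'d::finite \<Rightarrow> ereal) \<Rightarrow> ereal" where
  "esssup_torus f = Inf {c. AE \<theta> in lborel. \<theta> \<in> torus \<longrightarrow> f \<theta> \<le> c}"

end

theory Submission
  imports Defs
begin

text \<open>
  Writing quaternions as $z + w\mathbf{j}$ turns $T_n(F)$ into the ordinary complex block Toeplitz
  matrix of $G_\tau$, up to a permutation. Since all the matrices $T_n(F)$ are Hermitian, the Fourier
  coefficients of $G_\tau$ and of its conjugate transpose agree, and uniqueness of Fourier
  coefficients in $L^1(\mathbb{T}^d)$ makes $G_\tau(\theta)$ Hermitian almost everywhere. An
  eigenvector of $T_n(F)$ for the eigenvalue $r$ is then read as the coefficient vector of a trigonometric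
  polynomial $P$; integrating the pointwise Rayleigh bounds
  $m\,|P|^2 \le P^* G_\tau P \le M\,|P|^2$ over the torus gives $m \le r \le M$.
\<close>

section \<open>Uniqueness of Fourier coefficients in $L^1$ of the torus\<close>

text \<open>Left multiplication by \<open>z + w j\<close> is linear over right complex scalars,
  hence a 2 by 2 complex matrix with rows (z, w) and (-conj w, conj z); Fourier coefficients inherit
  this pattern. Two facts decide where the blocks of \<open>Gsym\<close> are evaluated. Since j c =
  conj(c) j, the right-hand phases of the sandwich reach the \<open>W\<close> part conjugated, which
  a reflection of the right-hand variables undoes. And conjugating a Fourier coefficient amounts to
  replacing g(t) by conj(g(-t)), which accounts for the arguments in the lower row.

  The entries are only integrable, so uniqueness of coefficients cannot come from a Hilbert space
  argument; it is reached by enlarging the class of test functions up to indicators of Borel sets.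
  Hermitian symmetry of the symbol is indispensable for the Rayleigh bounds, because eigenvalues of
  a general matrix do not control its quadratic form. A recurring obstacle is the half-open cube,
  which is neither compact nor invariant under reflections.\<close>

abbreviation tchar :: "('d \<Rightarrow> int) \<Rightarrow> real^'d::finite \<Rightarrow> complex" where
  "tchar k \<theta> \<equiv> cis (pairS UNIV k \<theta>)"

lemma continuous_on_pairS [continuous_intros]: "continuous_on A (pairS S k)"
  unfolding pairS_def by (intro continuous_intros)

lemma borel_measurable_pairS [measurable]: "pairS S k \<in> borel_measurable borel"
  by (intro borel_measurable_continuous_onI continuous_intros)

lemma borel_measurable_cis [measurable]: "cis \<in> borel_measurable borel"
  by (intro borel_measurable_continuous_onI continuous_intros)

lemma torus_sets [measurable]: "(torus :: (real^'d::finite) set) \<in> sets borel"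
proof -
  have [measurable]: "(\<lambda>\<theta>::real^'d. \<theta> $ j) \<in> borel_measurable borel" for j
    by (intro borel_measurable_continuous_onI continuous_intros)
  show ?thesis unfolding torus_def by measurable
qed

text \<open>Only monomials and sums are generators, so that statements linear in the function, such
  as the vanishing of an integral, follow by rule induction. Closure under products is derived
  afterwards.\<close>

inductive_set trig_poly :: "(real^'d::finite \<Rightarrow> complex) set" where
  monomial: "(\<lambda>\<theta>. c * tchar k \<theta>) \<in> trig_poly"
| add: "f \<in> trig_poly \<Longrightarrow> g \<in> trig_poly \<Longrightarrow> (\<lambda>\<theta>. f \<theta> + g \<theta>) \<in> trig_poly"

lemma trig_poly_const: "(\<lambda>\<theta>. c) \<in> trig_poly"
  using trig_poly.monomial[of c "\<lambda>_. 0"] by (simp add: pairS_def)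

lemma trig_poly_sum:
  "(\<And>i. i \<in> I \<Longrightarrow> f i \<in> trig_poly) \<Longrightarrow> (\<lambda>\<theta>. \<Sum>i\<in>I. f i \<theta>) \<in> trig_poly"
  by (induction I rule: infinite_finite_induct) (auto intro: trig_poly_const trig_poly.add)

lemma trig_poly_monomial_mult:
  "g \<in> trig_poly \<Longrightarrow> (\<lambda>\<theta>. c * tchar k \<theta> * g \<theta>) \<in> trig_poly"
proof (induction rule: trig_poly.induct)
  case (monomial c' k')
  have "(\<lambda>\<theta>. (c * c') * tchar (\<lambda>j. k j + k' j) \<theta>) \<in> trig_poly"
    by (rule trig_poly.monomial)
  moreover have "(\<lambda>\<theta>. (c * c') * tchar (\<lambda>j. k j + k' j) \<theta>) = (\<lambda>\<theta>. c * tchar k \<theta> * (c' * tchar k' \<theta>))"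
    by (simp add: fun_eq_iff pairS_def distrib_right sum.distrib cis_mult[symmetric])
  ultimately show ?case by simp
qed (auto simp: distrib_left intro: trig_poly.add)

lemma trig_poly_mult:
  "f \<in> trig_poly \<Longrightarrow> g \<in> trig_poly \<Longrightarrow> (\<lambda>\<theta>. f \<theta> * g \<theta>) \<in> trig_poly"
  by (induction rule: trig_poly.induct)
     (auto simp: distrib_right intro: trig_poly.add trig_poly_monomial_mult)

text \<open>
  Pulling back along the embedding into $\mathbb{C}^d$ makes trigonometric polynomials out of
  real polynomials, so that the Stone--Weierstrass theorem on a compact subset of
  $\mathbb{C}^d$ applies.
\<close>

definition torus_emb :: "real^'d \<Rightarrow> complex^'d::finite" where
  "torus_emb \<theta> = (\<chi> j. cis (\<theta> $ j))"

lemma continuous_on_torus_emb [continuous_intros]: "continuous_on A torus_emb"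
  unfolding torus_emb_def by (intro continuous_intros)

lemma torus_emb_measurable [measurable]: "torus_emb \<in> borel_measurable borel"
  by (intro borel_measurable_continuous_onI continuous_intros)

text \<open>Coordinates in the half-open interval differ by less than 2 pi, so equal values of
  \<open>cis\<close> leave only the multiple 0. Injectivity later separates a compact subset of the
  torus from the remaining points.\<close>

lemma inj_on_torus_emb: "inj_on torus_emb torus"
proof (rule inj_onI)
  fix x y :: "real^'d" assume xy: "x \<in> torus" "y \<in> torus" "torus_emb x = torus_emb y"
  have "x $ j = y $ j" for j
  proof -
    have "cis (x $ j) = cis (y $ j)"
      using xy(3) by (simp add: torus_emb_def vec_eq_iff)
    then obtain n :: int where n: "x $ j = y $ j + 2 * pi * n"
      by (metis cis.sel sin_cos_eq_iff)
    have "\<bar>x $ j - y $ j\<bar> < 2 * pi"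
      using xy(1,2) by (auto simp: torus_def abs_less_iff) (smt (verit))+
    hence "2 * pi * \<bar>real_of_int n\<bar> < 2 * pi * 1"
      using n by (simp add: abs_mult)
    hence "n = 0" by (subst (asm) mult_less_cancel_left_pos) auto
    thus ?thesis using n by simp
  qed
  thus "x = y" by (simp add: vec_eq_iff)
qed

text \<open>With \<open>b = axis j u\<close>, the inner product is the real part of conj(u) e^(i t),
  where t is the coordinate \<open>j\<close>, that is, half the sum of conj(u) e^(i t) and u e^(-i
  t).\<close>

lemma trig_poly_torus_emb_inner:
  "(\<lambda>\<theta>. complex_of_real (torus_emb \<theta> \<bullet> b)) \<in> trig_poly" if "b \<in> Basis" for b :: "complex^'d::finite"
proof -
  obtain j u where b: "b = axis j u"
    using \<open>b \<in> Basis\<close> by (auto simp: Basis_vec_def)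
  define k :: "'d \<Rightarrow> int" where "k i = (if i = j then 1 else 0)" for i
  have k: "pairS UNIV k \<theta> = \<theta> $ j" "pairS UNIV (\<lambda>i. - k i) \<theta> = - (\<theta> $ j)" for \<theta>
    by (simp_all add: pairS_def k_def if_distrib[of "\<lambda>x. - x"] if_distrib[of real_of_int] if_distrib[of "\<lambda>x. x * _"] cong: if_cong)
  have "(\<lambda>\<theta>. (cnj u / 2) * tchar k \<theta> + (u / 2) * tchar (\<lambda>i. - k i) \<theta>) \<in> trig_poly"
    by (intro trig_poly.intros)
  also have "(\<lambda>\<theta>. (cnj u / 2) * tchar k \<theta> + (u / 2) * tchar (\<lambda>i. - k i) \<theta>) =
      (\<lambda>\<theta>. complex_of_real (torus_emb \<theta> \<bullet> b))"
    by (auto simp: fun_eq_iff b k torus_emb_def inner_axis complex_eq_iff inner_complex_def field_simps)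
  finally show ?thesis .
qed

lemma real_polynomial_function_trig_poly:
  "real_polynomial_function p \<Longrightarrow> (\<lambda>\<theta>. complex_of_real (p (torus_emb \<theta>))) \<in> trig_poly"
proof (induction rule: real_polynomial_function.induct)
  case (linear f)
  have "f x = (\<Sum>b\<in>Basis. (x \<bullet> b) * f b)" for x
  proof -
    have "f x = f (\<Sum>b\<in>Basis. (x \<bullet> b) *\<^sub>R b)" by (simp add: euclidean_representation)
    also have "\<dots> = (\<Sum>b\<in>Basis. (x \<bullet> b) * f b)"
      using linear by (simp add: linear_simps bounded_linear.linear linear_sum)
    finally show ?thesis .
  qed
  hence "(\<lambda>\<theta>. complex_of_real (f (torus_emb \<theta>))) =
      (\<lambda>\<theta>. \<Sum>b\<in>Basis. complex_of_real (torus_emb \<theta> \<bullet> b) * complex_of_real (f b))"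
    by (metis (no_types, lifting) of_real_mult of_real_sum sum.cong)
  moreover have "(\<lambda>\<theta>. \<Sum>b\<in>Basis. complex_of_real (torus_emb \<theta> \<bullet> b) * complex_of_real (f b)) \<in> trig_poly"
    by (intro trig_poly_sum trig_poly_mult trig_poly_torus_emb_inner trig_poly_const)
  ultimately show ?case by simp
qed (auto intro: trig_poly_const trig_poly.add trig_poly_mult)

lemma trig_poly_bounded_continuous:
  assumes "h \<in> trig_poly"
  shows "continuous_on UNIV h \<and> (\<exists>B. \<forall>\<theta>. norm (h \<theta>) \<le> B)"
  using assms
proof (induction rule: trig_poly.induct)
  case (monomial c k)
  show ?case by (auto simp: norm_mult intro!: continuous_intros)
next
  case (add f g)
  then obtain A B where "\<forall>\<theta>. norm (f \<theta>) \<le> A" "\<forall>\<theta>. norm (g \<theta>) \<le> B" by blast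
  hence "norm (f \<theta> + g \<theta>) \<le> A + B" for \<theta>
    by (meson add_mono norm_triangle_le)
  thus ?case using add by (auto intro!: continuous_intros)
qed

lemma integrable_mult_bounded:
  fixes g h :: "'b::euclidean_space \<Rightarrow> complex"
  assumes "integrable lborel g" "h \<in> borel_measurable borel" "\<And>x. norm (h x) \<le> B"
  shows "integrable lborel (\<lambda>x. g x * h x)"
proof (rule Bochner_Integration.integrable_bound[of _ "\<lambda>x. B * norm (g x)"])
  show "integrable lborel (\<lambda>x. B * norm (g x))" using assms(1) by simp
  show "(\<lambda>x. g x * h x) \<in> borel_measurable lborel"
    using assms(1,2) by measurable
  have "0 \<le> B" using assms(3)[of 0] norm_ge_zero order_trans by blast
  show "AE x in lborel. norm (g x * h x) \<le> norm (B * norm (g x))"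
    using assms(3) \<open>0 \<le> B\<close> by (auto simp: norm_mult abs_mult mult.commute[of B] intro!: mult_left_mono)
qed

section \<open>Enlarging the class of test functions, from trigonometric polynomials to Borel
  sets\<close>

context
  fixes g :: "real^'d::finite \<Rightarrow> complex"
  assumes int: "integrable lborel g"
    and supp: "\<And>\<theta>. \<theta> \<notin> torus \<Longrightarrow> g \<theta> = 0"
    and zero: "\<And>k. (LINT \<theta>|lborel. g \<theta> * tchar k \<theta>) = 0"
begin

lemma integral_trig_poly_zero:
  "h \<in> trig_poly \<Longrightarrow> integrable lborel (\<lambda>\<theta>. g \<theta> * h \<theta>) \<and> (LINT \<theta>|lborel. g \<theta> * h \<theta>) = 0"
proof (induction rule: trig_poly.induct)
  case (monomial c k)
  have "integrable lborel (\<lambda>\<theta>. g \<theta> * tchar k \<theta>)"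
    by (rule integrable_mult_bounded[OF int, of _ 1]) auto
  hence "integrable lborel (\<lambda>\<theta>. c * (g \<theta> * tchar k \<theta>))" "(LINT \<theta>|lborel. c * (g \<theta> * tchar k \<theta>)) = 0"
    using zero[of k] by auto
  thus ?case by (simp add: mult.left_commute)
qed (simp add: distrib_left)

text \<open>A polynomial within \<open>e\<close> of \<open>\<phi>\<close> on the compact image pulls
  back to a trigonometric polynomial, against which \<open>g\<close> integrates to 0. Only the error
  remains, and it is at most \<open>e\<close> times the L1 norm of \<open>g\<close>.\<close>

lemma integral_continuous_zero:
  assumes "continuous_on UNIV \<phi>"
  shows "(LINT \<theta>|lborel. g \<theta> * complex_of_real (\<phi> (torus_emb \<theta>))) = 0"
proof -
  \<comment> \<open>The closed cube replaces the torus because Stone-Weierstrass needs a compact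
    image.\<close>
  define Q :: "(real^'d) set" where "Q = cbox (\<chi> j. - pi) (\<chi> j. pi)"
  have TQ: "torus \<subseteq> Q" by (auto simp: torus_def Q_def mem_box_cart less_imp_le)
  have cS: "compact (torus_emb ` Q)"
    unfolding Q_def by (intro compact_continuous_image continuous_intros compact_cbox)
  have meas: "\<phi> \<in> borel_measurable borel"
    using assms by (rule borel_measurable_continuous_onI)
  have le: "norm (LINT \<theta>|lborel. g \<theta> * complex_of_real (\<phi> (torus_emb \<theta>))) \<le> e * (LINT \<theta>|lborel. norm (g \<theta>))"
    if e: "e > 0" for e
  proof -
    obtain p where p: "real_polynomial_function p"
        "\<And>x. x \<in> torus_emb ` Q \<Longrightarrow> \<bar>\<phi> x - p x\<bar> < e"
      using Stone_Weierstrass_real_polynomial_function[OF cS continuous_on_subset[OF assms subset_UNIV] e]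
      by blast
    define h where "h = (\<lambda>\<theta>. complex_of_real (p (torus_emb \<theta>)))"
    have h: "h \<in> trig_poly" unfolding h_def using p(1) by (rule real_polynomial_function_trig_poly)
    have [measurable]: "g \<in> borel_measurable borel" using int by (auto dest: borel_measurable_integrable)
    have [measurable]: "h \<in> borel_measurable borel"
      using trig_poly_bounded_continuous[OF h] by (auto intro: borel_measurable_continuous_onI)
    note [measurable] = meas
    have b: "norm (g \<theta> * (complex_of_real (\<phi> (torus_emb \<theta>)) - h \<theta>)) \<le> e * norm (g \<theta>)" for \<theta>
    proof (cases "\<theta> \<in> torus")
      case True
      hence "norm (complex_of_real (\<phi> (torus_emb \<theta>)) - h \<theta>) \<le> e"
        using p(2)[of "torus_emb \<theta>"] TQ by (auto simp: h_def norm_of_real simp flip: of_real_diff)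
      thus ?thesis by (auto simp: norm_mult mult.commute[of e] intro: mult_left_mono)
    qed (simp add: supp)
    have i1: "integrable lborel (\<lambda>\<theta>. g \<theta> * (complex_of_real (\<phi> (torus_emb \<theta>)) - h \<theta>))"
      by (rule Bochner_Integration.integrable_bound[of _ "\<lambda>\<theta>. e * norm (g \<theta>)"])
         (use int b e in \<open>auto simp: abs_mult\<close>)
    have "(LINT \<theta>|lborel. g \<theta> * complex_of_real (\<phi> (torus_emb \<theta>))) =
       (LINT \<theta>|lborel. g \<theta> * (complex_of_real (\<phi> (torus_emb \<theta>)) - h \<theta>) + g \<theta> * h \<theta>)"
      by (simp add: algebra_simps)
    also have "\<dots> = (LINT \<theta>|lborel. g \<theta> * (complex_of_real (\<phi> (torus_emb \<theta>)) - h \<theta>))"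
      using integral_trig_poly_zero[OF h] i1 by simp
    also have "norm \<dots> \<le> (LINT \<theta>|lborel. e * norm (g \<theta>))"
      by (rule Bochner_Integration.integral_norm_bound_integral[OF i1]) (use int b in auto)
    finally show ?thesis by simp
  qed
  have "norm (LINT \<theta>|lborel. g \<theta> * complex_of_real (\<phi> (torus_emb \<theta>))) \<le> 0"
  proof (rule field_le_epsilon)
    fix e :: real assume "e > 0"
    \<comment> \<open>The target error is divided by \<open>I + 1\<close> below, so that the case of
      norm zero needs no separate treatment.\<close>
    define I where "I = (LINT \<theta>|lborel. norm (g \<theta>))"
    have "I \<ge> 0" unfolding I_def by simp
    hence "e / (I + 1) * I \<le> e" using \<open>e > 0\<close> by (simp add: field_simps)
    moreover have "e / (I + 1) > 0" using \<open>e > 0\<close> \<open>I \<ge> 0\<close> by simp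
    ultimately show "norm (LINT \<theta>|lborel. g \<theta> * complex_of_real (\<phi> (torus_emb \<theta>))) \<le> 0 + e"
      using le[of "e / (I + 1)"] unfolding I_def by linarith
  qed
  thus ?thesis by simp
qed

text \<open>The indicator of \<open>K\<close> is the pointwise limit on the torus of continuous
  tents in the distance to the image \<open>C\<close>. A point of the torus outside \<open>K\<close>
  has positive distance to \<open>C\<close> because the embedding is injective there and
  \<open>C\<close> is closed; the norm of \<open>g\<close> dominates.\<close>

lemma integral_compact_zero:
  assumes "compact K" "K \<subseteq> torus"
  shows "(LINT \<theta>:K|lborel. g \<theta>) = 0"
proof (cases "K = {}")
  case False
  define C where "C = torus_emb ` K"
  have C: "closed C" "C \<noteq> {}"
    unfolding C_def using assms(1) False
    by (auto intro!: compact_imp_closed compact_continuous_image continuous_intros)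
  define \<phi> :: "nat \<Rightarrow> complex^'d \<Rightarrow> real" where "\<phi> n z = max 0 (1 - real n * infdist z C)" for n z
  have cont: "continuous_on UNIV (\<phi> n)" for n unfolding \<phi>_def by (intro continuous_intros)
  have [measurable]: "\<phi> n \<in> borel_measurable borel" for n
    using cont by (rule borel_measurable_continuous_onI)
  have [measurable]: "g \<in> borel_measurable borel" using int by (auto dest: borel_measurable_integrable)
  have [measurable]: "K \<in> sets borel" using assms(1) by (auto intro: borel_closed compact_imp_closed)
  have lim: "(\<lambda>n. g \<theta> * complex_of_real (\<phi> n (torus_emb \<theta>))) \<longlonglongrightarrow> indicator K \<theta> *\<^sub>R g \<theta>" for \<theta>
  proof (cases "\<theta> \<in> torus")
    case True
    show ?thesis
    proof (cases "\<theta> \<in> K")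
      case True
      thus ?thesis by (simp add: \<phi>_def C_def)
    next
      case False
      hence "torus_emb \<theta> \<notin> C" unfolding C_def
        using True assms(2) inj_on_torus_emb by (metis inj_on_image_mem_iff)
      hence pos: "infdist (torus_emb \<theta>) C > 0"
        using C by (metis infdist_pos_not_in_closed)
      obtain N :: nat where N: "1 < real N * infdist (torus_emb \<theta>) C"
        using reals_Archimedean3[OF pos] by blast
      have "\<forall>\<^sub>F n in sequentially. g \<theta> * complex_of_real (\<phi> n (torus_emb \<theta>)) = 0"
      proof (rule eventually_sequentiallyI[of N])
        fix n assume "N \<le> n"
        hence "real N * infdist (torus_emb \<theta>) C \<le> real n * infdist (torus_emb \<theta>) C"
          using pos by (intro mult_right_mono) auto
        with N show "g \<theta> * complex_of_real (\<phi> n (torus_emb \<theta>)) = 0" by (simp add: \<phi>_def)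
      qed
      thus ?thesis using False by (simp add: tendsto_eventually)
    qed
  qed (simp add: supp)
  have "(\<lambda>n. LINT \<theta>|lborel. g \<theta> * complex_of_real (\<phi> n (torus_emb \<theta>))) \<longlonglongrightarrow> (LINT \<theta>|lborel. indicator K \<theta> *\<^sub>R g \<theta>)"
  proof (rule integral_dominated_convergence[where w = "\<lambda>\<theta>. norm (g \<theta>)"])
    have "\<bar>\<phi> n z\<bar> \<le> 1" for n z
      using infdist_nonneg[of z C] by (auto simp: \<phi>_def max_def)
    thus "AE x in lborel. norm (g x * complex_of_real (\<phi> i (torus_emb x))) \<le> norm (g x)" for i
      by (auto simp: norm_mult intro!: mult_left_le)
  qed (use int lim in auto)
  thus ?thesis unfolding set_lebesgue_integral_def
    using integral_continuous_zero[OF cont] by (simp add: LIMSEQ_const_iff)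
qed (simp add: set_lebesgue_integral_def)

text \<open>A closed set need not meet the torus in a compact set, as the upper faces are missing.
  Pulling these faces in by \<open>1 / real (Suc m)\<close> gives compact pieces that increase to
  the whole intersection.\<close>

lemma integral_closed_zero:
  assumes "closed A"
  shows "(LINT \<theta>:A|lborel. g \<theta>) = 0"
proof -
  define K :: "nat \<Rightarrow> (real^'d) set" where
    "K m = A \<inter> cbox (\<chi> j. - pi) (\<chi> j. pi - 1 / real (Suc m))" for m
  have cK: "compact (K m)" for m unfolding K_def using assms by (simp add: closed_Int_compact)
  have sub: "K m \<subseteq> torus" for m
  proof -
    have "0 < 1 / real (Suc m)" by simp
    hence "x < pi" if "x \<le> pi - 1 / real (Suc m)" for x
      using that by linarith
    thus ?thesis unfolding K_def torus_def by (auto simp: mem_box_cart simp del: of_nat_Suc)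
  qed
  have mono: "incseq K"
  proof (rule incseq_SucI)
    fix m
    have "1 / real (Suc (Suc m)) \<le> 1 / real (Suc m)" by (simp add: field_simps)
    hence "x \<le> pi - 1 / real (Suc (Suc m))" if "x \<le> pi - 1 / real (Suc m)" for x
      using that by linarith
    thus "K m \<le> K (Suc m)" unfolding K_def 
      by (auto simp: mem_box_cart simp del: of_nat_Suc)
  qed
  have U: "(\<Union>m. K m) = A \<inter> torus"
  proof
    show "(\<Union>m. K m) \<subseteq> A \<inter> torus" using sub by (auto simp: K_def)
    show "A \<inter> torus \<subseteq> (\<Union>m. K m)"
    proof
      fix x assume x: "x \<in> A \<inter> torus"
      define d where "d = Min (range (\<lambda>j. pi - x $ j))"
      have "d > 0" unfolding d_def using x by (subst Min_gr_iff) (auto simp: torus_def)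
      then obtain m where m: "1 / real (Suc m) < d" using nat_approx_posE by blast
      have "x $ j \<le> pi - 1 / real (Suc m)" for j
      proof -
        have "d \<le> pi - x $ j" unfolding d_def by (rule Min_le) auto
        thus ?thesis using m by linarith
      qed
      hence "x \<in> K m" using x unfolding K_def by (auto simp: mem_box_cart torus_def simp del: of_nat_Suc)
      thus "x \<in> (\<Union>m. K m)" by blast
    qed
  qed
  have [measurable]: "A \<in> sets borel" using assms by (rule borel_closed)
  have "(\<lambda>m. LINT \<theta>:K m|lborel. g \<theta>) \<longlonglongrightarrow> (LINT \<theta>:(\<Union>m. K m)|lborel. g \<theta>)"
  proof (rule set_integral_cont_up[OF _ mono])
    show "K m \<in> sets lborel" for m using cK by (auto intro: borel_closed compact_imp_closed)
    show "set_integrable lborel (\<Union>m. K m) g"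
      unfolding U set_integrable_def by (rule integrable_mult_indicator) (use int in auto)
  qed
  hence "(LINT \<theta>:A \<inter> torus|lborel. g \<theta>) = 0"
    unfolding U using integral_compact_zero[OF cK sub] by (simp add: LIMSEQ_const_iff)
  also have "(LINT \<theta>:A \<inter> torus|lborel. g \<theta>) = (LINT \<theta>:A|lborel. g \<theta>)"
    unfolding set_lebesgue_integral_def
    by (intro Bochner_Integration.integral_cong) (use supp in \<open>auto simp: indicator_def\<close>)
  finally show ?thesis .
qed

text \<open>Closed sets are stable under intersection and generate the Borel sets, so Dynkin's
  theorem extends the vanishing of set integrals to all Borel sets. The complement case uses that
  the whole space is itself closed and so has integral 0.\<close>

lemma fourier_uniqueness: "AE \<theta> in lborel. g \<theta> = 0"
proof (rule sigma_finite_measure.density_zero[OF sigma_finite_lborel int])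
  fix A :: "(real^'d) set" assume "A \<in> sets lborel"
  hence A: "A \<in> sigma_sets UNIV (Collect closed)" by (simp add: borel_eq_closed)
  have si: "set_integrable lborel B g" if "B \<in> sets borel" for B
    unfolding set_integrable_def by (rule integrable_mult_indicator) (use int that in auto)
  have bs: "sigma_sets UNIV (Collect closed) = sets (borel :: (real^'d) measure)" by (simp add: borel_eq_closed)
  have "Int_stable (Collect closed :: (real^'d) set set)" by (auto simp: Int_stable_def)
  moreover have "Collect closed \<subseteq> Pow (UNIV :: (real^'d) set)" by simp
  ultimately show "(LINT \<theta>:A|lborel. g \<theta>) = 0"
    using A
  proof (induction rule: sigma_sets_induct_disjoint)
    case (basic A)
    thus ?case by (simp add: integral_closed_zero)
  next
    case empty show ?case by (simp add: set_lebesgue_integral_def)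
  next
    case (compl A)
    hence A: "A \<in> sets borel" using bs by auto
    have "(LINT \<theta>:A \<union> (UNIV - A)|lborel. g \<theta>) = (LINT \<theta>:A|lborel. g \<theta>) + (LINT \<theta>:UNIV - A|lborel. g \<theta>)"
      by (rule set_integral_Un) (use A si in auto)
    moreover have "(LINT \<theta>:A \<union> (UNIV - A)|lborel. g \<theta>) = 0"
      using integral_closed_zero[of UNIV] by simp
    ultimately show ?case using compl.IH by simp
  next
    case (union B)
    hence B: "B i \<in> sets borel" for i using bs by auto
    have "(LINT \<theta>:(\<Union>i. B i)|lborel. g \<theta>) = (\<Sum>i. LINT \<theta>:B i|lborel. g \<theta>)"
      by (rule lebesgue_integral_countable_add)
         (use B si union.hyps in \<open>auto simp: disjoint_family_on_def\<close>)
    thus ?case using union by simp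
  qed
qed

end

section \<open>Reflections and orthogonality of characters\<close>

lemma reflS_UNIV: "reflS UNIV \<theta> = - \<theta>"
  by (simp add: reflS_def vec_eq_iff)

lemma reflS_uminus: "reflS S (- \<theta>) = reflS (- S) \<theta>"
  by (simp add: reflS_def vec_eq_iff)

lemma reflS_reflS: "reflS S (reflS S \<theta>) = \<theta>"
  by (simp add: reflS_def vec_eq_iff)

lemma reflS_measurable [measurable]: "(reflS S :: real^'d::finite \<Rightarrow> _) \<in> borel_measurable borel"
proof (rule borel_measurable_continuous_onI)
  have "continuous_on UNIV (\<lambda>\<theta> :: real^'d. if j \<in> S then - (\<theta> $ j) else \<theta> $ j)" for j
    by (cases "j \<in> S") (auto intro!: continuous_intros)
  thus "continuous_on UNIV (reflS S :: real^'d \<Rightarrow> _)"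
    unfolding reflS_def by (rule continuous_on_vec_lambda)
qed

text \<open>In the standard basis a reflection is diagonal with entries 1 and -1, so the scaling
  factor of Lebesgue measure is 1.\<close>

lemma lborel_distr_reflS: "distr lborel borel (reflS S) = (lborel :: (real^'d::finite) measure)"
proof -
  define c :: "real^'d \<Rightarrow> real" where "c b = (if b \<in> (\<lambda>j. axis j 1) ` S then -1 else 1)" for b
  have "reflS S x \<bullet> b = c b * (x \<bullet> b)" if bB: "b \<in> Basis" for x b
  proof -
    obtain j where b: "b = axis j 1" using bB by (auto simp: Basis_vec_def)
    have "(axis j (1::real) \<in> (\<lambda>j. axis j 1) ` S) \<longleftrightarrow> j \<in> S"
      by (auto simp: axis_eq_axis)
    thus ?thesis by (simp add: b c_def inner_axis reflS_def)
  qed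
  hence "(\<Sum>b\<in>Basis. (c b * (x \<bullet> b)) *\<^sub>R b) = reflS S x" for x
    by (metis (no_types, lifting) euclidean_representation sum.cong)
  moreover have "(\<Prod>b\<in>Basis. \<bar>c b\<bar>) = 1" by (auto intro!: prod.neutral simp: c_def)
  ultimately have "lborel = density (distr lborel borel (reflS S)) (\<lambda>_. 1)"
    using lborel_affine_euclidean[of c 0] by (simp add: c_def)
  thus ?thesis by (simp add: density_1)
qed

lemma integral_reflS:
  fixes g :: "real^'d::finite \<Rightarrow> complex"
  assumes "integrable lborel g"
  shows "integrable lborel (\<lambda>\<theta>. g (reflS S \<theta>))"
    and "(LINT \<theta>|lborel. g (reflS S \<theta>)) = (LINT \<theta>|lborel. g \<theta>)"
proof -
  have "integrable (distr lborel borel (reflS S)) g"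
    unfolding lborel_distr_reflS by fact
  thus "integrable lborel (\<lambda>\<theta>. g (reflS S \<theta>))"
    by (rule integrable_distr[rotated]) simp
  have "g \<in> borel_measurable borel" using assms by (auto dest: borel_measurable_integrable)
  hence "(LINT \<theta>|distr lborel borel (reflS S). g \<theta>) = (LINT \<theta>|lborel. g (reflS S \<theta>))"
    by (intro integral_distr) auto
  thus "(LINT \<theta>|lborel. g (reflS S \<theta>)) = (LINT \<theta>|lborel. g \<theta>)"
    by (simp add: lborel_distr_reflS)
qed

text \<open>Reflections can move only the faces with a coordinate \<open>pi\<close> or
  \<open>- pi\<close> into or out of the half-open cube. These hyperplanes are null, and one
  exceptional set serves all \<open>S\<close> at once.\<close>

lemma AE_reflS_torus: "AE \<theta> in lborel. \<forall>S. reflS S \<theta> \<in> torus \<longleftrightarrow> (\<theta> :: real^'d::finite) \<in> torus"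
proof -
  have *: "AE \<theta> in lborel. (\<theta> :: real^'d) $ j \<noteq> a" for j a
  proof -
    have "closed {\<theta> :: real^'d. \<theta> $ j = a}"
      by (intro closed_Collect_eq continuous_intros)
    hence "{\<theta> :: real^'d. \<theta> $ j = a} \<in> null_sets lborel"
      using negligible_standard_hyperplane[of "axis j (1::real)" a]
      by (simp add: cart_eq_inner_axis negligible_iff_null_sets null_sets_completion_iff borel_closed)
    from AE_not_in[OF this] show ?thesis by simp
  qed
  have "AE \<theta> in lborel. \<forall>j. (\<theta> :: real^'d) $ j \<noteq> pi \<and> \<theta> $ j \<noteq> - pi"
    using * by (simp add: AE_all_countable)
  thus ?thesis
  proof eventually_elim
    case (elim \<theta>)
    show ?case
    proof
      fix S
      have "(- pi \<le> reflS S \<theta> $ j \<and> reflS S \<theta> $ j < pi) \<longleftrightarrow> (- pi \<le> \<theta> $ j \<and> \<theta> $ j < pi)" for j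
        using elim[rule_format, of j] by (auto simp: reflS_def)
      thus "reflS S \<theta> \<in> torus \<longleftrightarrow> \<theta> \<in> torus" by (simp add: torus_def)
    qed
  qed
qed

lemma integral_cis_period:
  fixes n :: int
  shows "integrable lborel (\<lambda>x::real. indicator {-pi..<pi} x * cis (real_of_int n * x))"
    and "(LINT x|lborel. indicator {-pi..<pi} x * cis (real_of_int n * x)) = (if n = 0 then 2 * pi else 0)"
proof -
  define F :: "real \<Rightarrow> complex" where
    "F x = (if n = 0 then of_real x else cis (real_of_int n * x) / (\<i> * of_int n))" for x :: real
  have F: "(F has_vector_derivative cis (real_of_int n * x)) (at x within {-pi..pi})" for x
  proof (cases "n = 0")
    case True
    thus ?thesis unfolding F_def by (auto intro!: derivative_eq_intros)
  next
    case False
    have "((\<lambda>x. cis (real_of_int n * x) / (\<i> * of_int n)) has_vector_derivative cis (real_of_int n * x)) (at x within {-pi..pi})"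
      unfolding cis_conv_exp using False
      by (auto intro!: derivative_eq_intros has_vector_derivative_real_field simp: field_simps)
    thus ?thesis using False by (simp add: F_def[abs_def])
  qed
  have *: "has_bochner_integral lborel (\<lambda>x. indicator {-pi..pi} x *\<^sub>R cis (real_of_int n * x)) (F pi - F (-pi))"
    by (rule has_bochner_integral_FTC_Icc) (use F in \<open>auto intro!: continuous_intros\<close>)
  have "F pi - F (-pi) = (if n = 0 then 2 * pi else 0)"
  proof (cases "n = 0")
    case False
    have "cis (n * pi) = cis (- (n * pi))"
      by (auto simp: complex_eq_iff sin_integer_2pi mult.commute)
    thus ?thesis using False by (simp add: F_def)
  qed (simp add: F_def)
  \<comment> \<open>The fundamental theorem was applied on the closed interval; dropping the single
    point \<open>pi\<close> does not affect the integral.\<close>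
  moreover have "has_bochner_integral lborel (\<lambda>x. indicator {-pi..<pi} x * cis (real_of_int n * x)) (F pi - F (-pi))"
    by (subst has_bochner_integral_discrete_difference[of "{pi}" _ _ "\<lambda>x. indicator {-pi..pi} x *\<^sub>R cis (real_of_int n * x)"])
       (use * in \<open>auto simp: indicator_def\<close>)
  ultimately show "integrable lborel (\<lambda>x::real. indicator {-pi..<pi} x * cis (real_of_int n * x))"
    and "(LINT x|lborel. indicator {-pi..<pi} x * cis (real_of_int n * x)) = (if n = 0 then 2 * pi else 0)"
    by (auto simp: has_bochner_integral_iff)
qed

text \<open>Indicator and character both factor over the coordinates, so Fubini reduces to the
  one-dimensional integral. The reindexing by \<open>ax\<close> is needed because
  \<open>lborel\<close> is presented as a product over \<open>Basis\<close> and not over coordinate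
  indices.\<close>

lemma integral_torus_tchar:
  fixes k :: "'d::finite \<Rightarrow> int"
  shows "(LINT \<theta>|lborel. indicator torus \<theta> * tchar k \<theta>) =
    (if \<forall>j. k j = 0 then (2 * pi) ^ CARD('d) else 0)"
proof -
  define ax :: "'d \<Rightarrow> real^'d" where "ax j = axis j 1" for j
  have inj: "inj ax" by (auto simp: inj_def ax_def axis_eq_axis)
  have B: "Basis = ax ` UNIV" by (auto simp: Basis_vec_def ax_def)
  define \<phi> :: "int \<Rightarrow> real \<Rightarrow> complex" where "\<phi> n x = indicator {-pi..<pi} x * cis (real_of_int n * x)" for n x
  define f where "f b = \<phi> (k (inv ax b))" for b
  have prod_Basis: "(\<Prod>b\<in>Basis. h (inv ax b) b) = (\<Prod>j\<in>UNIV. h j (ax j))" for h :: "'d \<Rightarrow> real^'d \<Rightarrow> complex"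
    unfolding B using inj by (simp add: prod.reindex)
  have "indicator torus \<theta> * tchar k \<theta> = (\<Prod>j\<in>UNIV. \<phi> (k j) (\<theta> $ j))" for \<theta>
  proof -
    have "tchar k \<theta> = (\<Prod>j\<in>UNIV. cis (k j * \<theta> $ j))"
      by (simp add: pairS_def cis_conv_exp sum_distrib_left exp_sum)
    moreover have "indicator torus \<theta> = (\<Prod>j\<in>UNIV. indicator {-pi..<pi} (\<theta> $ j) :: complex)"
      by (auto simp: torus_def indicator_def)
    ultimately show ?thesis by (simp add: \<phi>_def prod.distrib)
  qed
  moreover have "\<theta> $ j = \<theta> \<bullet> ax j" for \<theta> j by (simp add: ax_def inner_axis)
  ultimately have eq: "indicator torus \<theta> * tchar k \<theta> = (\<Prod>b\<in>Basis. f b (\<theta> \<bullet> b))" for \<theta>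
    unfolding f_def by (subst prod_Basis[of "\<lambda>j b. \<phi> (k j) (\<theta> \<bullet> b)"]) auto
  interpret P: product_sigma_finite "\<lambda>_::real^'d. lborel :: real measure" ..
  have [measurable]: "f b \<in> borel_measurable borel" for b
    unfolding f_def \<phi>_def by measurable
  have "(LINT \<theta>|lborel. indicator torus \<theta> * tchar k \<theta>) =
      (LINT \<theta>|distr (\<Pi>\<^sub>M b\<in>Basis. lborel) borel (\<lambda>f. \<Sum>b\<in>Basis. f b *\<^sub>R b). (\<Prod>b\<in>Basis. f b (\<theta> \<bullet> b)))"
    unfolding eq by (simp flip: lborel_eq)
  also have "\<dots> = (LINT x|(\<Pi>\<^sub>M b\<in>Basis. lborel). (\<Prod>b\<in>Basis. f b ((\<Sum>b\<in>Basis. x b *\<^sub>R b) \<bullet> b)))"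
    by (rule integral_distr) (auto intro!: borel_measurable_prod)
  also have "\<dots> = (LINT x|(\<Pi>\<^sub>M b\<in>Basis. lborel). (\<Prod>b\<in>Basis. f b (x b)))"
    by (intro Bochner_Integration.integral_cong prod.cong refl) simp
  also have "\<dots> = (\<Prod>b\<in>Basis. integral\<^sup>L lborel (f b))"
    by (rule P.product_integral_prod) (auto simp: f_def \<phi>_def intro: integral_cis_period)
  also have "\<dots> = (\<Prod>j\<in>UNIV. integral\<^sup>L lborel (\<phi> (k j)))"
    unfolding f_def by (rule prod_Basis[of "\<lambda>j b. integral\<^sup>L lborel (\<phi> (k j))"])
  also have "\<dots> = (\<Prod>j\<in>UNIV. if k j = 0 then 2 * pi else 0)"
    by (simp add: \<phi>_def[abs_def] integral_cis_period)
  also have "\<dots> = (if \<forall>j. k j = 0 then (2 * pi) ^ CARD('d) else 0)"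
    by auto
  finally show ?thesis .
qed

section \<open>Hermitian forms\<close>

definition herm_form :: "('i::finite \<Rightarrow> 'i \<Rightarrow> complex) \<Rightarrow> ('i \<Rightarrow> complex) \<Rightarrow> ('i \<Rightarrow> complex) \<Rightarrow> complex" where
  "herm_form G x y = (\<Sum>i\<in>UNIV. \<Sum>j\<in>UNIV. cnj (y i) * G i j * x j)"

lemma herm_form_commute:
  assumes "\<And>i j. G i j = cnj (G j i)"
  shows "herm_form G y x = cnj (herm_form G x y)"
proof -
  have "cnj (herm_form G x y) = (\<Sum>i\<in>UNIV. \<Sum>j\<in>UNIV. y i * cnj (G i j) * cnj (x j))"
    by (simp add: herm_form_def)
  also have "\<dots> = (\<Sum>i\<in>UNIV. \<Sum>j\<in>UNIV. cnj (x j) * G j i * y i)"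
  proof (intro sum.cong refl)
    show "y i * cnj (G i j) * cnj (x j) = cnj (x j) * G j i * y i" for i j
      by (subst assms[of j i]) simp
  qed
  also have "\<dots> = herm_form G y x" unfolding herm_form_def by (rule sum.swap)
  finally show ?thesis by simp
qed

lemma herm_form_add_scaled:
  "herm_form G (\<lambda>i. x i + of_real t * w i) (\<lambda>i. x i + of_real t * w i) =
     herm_form G x x + of_real t * (herm_form G x w + herm_form G w x) + of_real (t\<^sup>2) * herm_form G w w"
  unfolding herm_form_def sum_distrib_left sum.distrib[symmetric]
  by (intro sum.cong refl) (simp add: algebra_simps power2_eq_square)

text \<open>Moving from \<open>u\<close> in the direction \<open>w\<close> = G u changes the form by
  \<open>2 * t * s + t\<^sup>2 * K\<close>, where \<open>s\<close> is the squared norm of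
  \<open>w\<close>. If \<open>s\<close> were positive, a small negative \<open>t\<close> would make
  this negative.\<close>

lemma psd_form_zero_imp_kernel:
  assumes herm: "\<And>i j. G i j = cnj (G j i)"
    and psd: "\<And>x. Re (herm_form G x x) \<ge> 0"
    and zero: "Re (herm_form G u u) = 0"
  shows "(\<Sum>j\<in>UNIV. G i j * u j) = 0"
proof -
  define w where "w i = (\<Sum>j\<in>UNIV. G i j * u j)" for i
  define s where "s = (\<Sum>i\<in>UNIV. (norm (w i))\<^sup>2)"
  define K where "K = Re (herm_form G w w)"
  have uw: "herm_form G u w = of_real s"
  proof -
    have "herm_form G u w = (\<Sum>i\<in>UNIV. cnj (w i) * w i)"
      unfolding herm_form_def by (simp add: w_def sum_distrib_left mult.assoc)
    also have "\<dots> = of_real s" by (simp only: s_def of_real_sum complex_norm_square mult.commute)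
    finally show ?thesis .
  qed
  have wu: "herm_form G w u = of_real s" using herm_form_commute[where G=G and y=w and x=u, OF herm] uw by simp
  have "s \<ge> 0" by (simp add: s_def sum_nonneg)
  have "K \<ge> 0" using psd by (simp add: K_def)
  have ineq: "0 \<le> 2 * t * s + t\<^sup>2 * K" for t
  proof -
    have "0 \<le> Re (herm_form G (\<lambda>i. u i + of_real t * w i) (\<lambda>i. u i + of_real t * w i))" by (rule psd)
    also have "\<dots> = 2 * t * s + t\<^sup>2 * K"
      unfolding herm_form_add_scaled uw wu using zero by (simp add: K_def flip: of_real_power)
    finally show ?thesis .
  qed
  have "s = 0"
  proof (rule ccontr)
    assume "s \<noteq> 0"
    \<comment> \<open>This \<open>t\<close> keeps \<open>t * K\<close> at least \<open>- s\<close>,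
      so that \<open>2 * s + t * K\<close> stays at least \<open>s\<close>; the \<open>+ 1\<close>
      covers \<open>K = 0\<close>.\<close>
    define t where "t = - s / (K + 1)"
    have t: "t < 0" using \<open>s \<noteq> 0\<close> \<open>s \<ge> 0\<close> \<open>K \<ge> 0\<close> by (simp add: t_def field_simps)
    have "0 \<le> t * (2 * s + t * K)" using ineq[of t] by (simp add: algebra_simps power2_eq_square)
    hence "2 * s + t * K \<le> 0" using t by (simp add: zero_le_mult_iff)
    moreover have "t * K \<ge> - s" using \<open>K \<ge> 0\<close> \<open>s \<ge> 0\<close> by (simp add: t_def field_simps)
    ultimately show False using \<open>s \<noteq> 0\<close> \<open>s \<ge> 0\<close> by linarith
  qed
  hence "(norm (w i))\<^sup>2 = 0" unfolding s_def by (subst (asm) sum_nonneg_eq_0_iff) auto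
  thus ?thesis by (simp add: w_def)
qed

text \<open>A variational argument in place of diagonalisation: let \<open>u\<close> minimise the
  form on the unit sphere. Subtracting \<open>q u\<close> from the diagonal leaves a positive
  semidefinite form that vanishes at \<open>u\<close>, so \<open>u\<close> lies in its kernel and is
  an eigenvector of \<open>G\<close> for \<open>q u\<close>. Thus \<open>c\<close> is at most the
  minimum. The vectors are moved to the type \<open>complex^'i\<close> for its norm and compact
  sphere.\<close>

lemma hermitian_form_ge_eigenvalue_bound:
  fixes G :: "'i::finite \<Rightarrow> 'i \<Rightarrow> complex"
  assumes herm: "\<And>i j. G i j = cnj (G j i)"
    and bound: "\<And>r. r \<in> real_eigenvalues G \<Longrightarrow> c \<le> r"
  shows "c * (\<Sum>i\<in>UNIV. (norm (v i))\<^sup>2) \<le> Re (herm_form G v v)"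
proof -
  define q :: "complex^'i \<Rightarrow> real" where "q x = Re (herm_form G (($) x) (($) x))" for x
  have "compact (sphere (0 :: complex^'i) 1)" by simp
  moreover have "sphere (0 :: complex^'i) 1 \<noteq> {}" by simp
  moreover have "continuous_on (sphere 0 1) q"
    unfolding q_def herm_form_def by (intro continuous_intros)
  ultimately have "\<exists>u\<in>sphere 0 1. \<forall>y\<in>sphere 0 1. q u \<le> q y"
    by (rule continuous_attains_inf)
  then obtain u where u: "u \<in> sphere 0 1" "\<And>y. y \<in> sphere 0 1 \<Longrightarrow> q u \<le> q y"
    by blast
  have norm_sq: "(norm x)\<^sup>2 = (\<Sum>i\<in>UNIV. (norm (x $ i))\<^sup>2)" for x :: "complex^'i"
    by (simp add: norm_vec_def L2_set_def sum_nonneg)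
  have ge: "q u * (norm x)\<^sup>2 \<le> q x" for x
  proof (cases "x = 0")
    case False
    define y where "y = (1 / norm x) *\<^sub>R x"
    have "x = norm x *\<^sub>R y" using False by (simp add: y_def)
    hence qx: "q x = q (norm x *\<^sub>R y)" by (rule arg_cong)
    have "herm_form G (($) (norm x *\<^sub>R y)) (($) (norm x *\<^sub>R y)) =
        of_real ((norm x)\<^sup>2) * herm_form G (($) y) (($) y)"
      unfolding herm_form_def sum_distrib_left
      by (intro sum.cong refl) (simp add: scaleR_conv_of_real[where 'a=complex] power2_eq_square)
    hence "q (norm x *\<^sub>R y) = (norm x)\<^sup>2 * q y"
      unfolding q_def by (simp del: of_real_power)
    with qx have "q x = (norm x)\<^sup>2 * q y" by simp
    moreover have "q u \<le> q y" using False by (intro u(2)) (simp add: y_def)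
    ultimately show ?thesis by (simp add: mult.commute mult_right_mono)
  qed (simp add: q_def herm_form_def)
  define H where "H i j = G i j - (if i = j then of_real (q u) else 0)" for i j
  have H: "herm_form H x x = herm_form G x x - of_real (q u * (\<Sum>i\<in>UNIV. (norm (x i))\<^sup>2))" for x
  proof -
    have "herm_form H x x = herm_form G x x -
        (\<Sum>i\<in>UNIV. \<Sum>j\<in>UNIV. if j = i then of_real (q u) * (x i * cnj (x i)) else 0)"
      unfolding herm_form_def H_def sum_subtractf[symmetric]
      by (intro sum.cong refl) (simp add: algebra_simps)
    also have "(\<Sum>i\<in>UNIV. \<Sum>j\<in>UNIV. if j = i then of_real (q u) * (x i * cnj (x i)) else 0) =
        of_real (q u * (\<Sum>i\<in>UNIV. (norm (x i))\<^sup>2))"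
      by (simp only: sum.delta finite_class.finite_UNIV UNIV_I if_True of_real_mult of_real_sum
            complex_norm_square sum_distrib_left)
    finally show ?thesis .
  qed
  have ker: "(\<Sum>j\<in>UNIV. H i j * u $ j) = 0" for i
  proof (rule psd_form_zero_imp_kernel)
    show "H i j = cnj (H j i)" for i j
      using herm[of i j] by (simp add: H_def)
    show "Re (herm_form H x x) \<ge> 0" for x
      using ge[of "\<chi> i. x i"] by (simp add: H norm_sq q_def vec_lambda_inverse)
    show "Re (herm_form H (($) u) (($) u)) = 0"
      using u(1) norm_sq[of u] by (simp add: H q_def)
  qed
  have "(\<Sum>j\<in>UNIV. G i j * u $ j) = of_real (q u) * u $ i" for i
  proof -
    have "(\<Sum>j\<in>UNIV. H i j * u $ j) =
        (\<Sum>j\<in>UNIV. G i j * u $ j) - (\<Sum>j\<in>UNIV. if j = i then of_real (q u) * u $ i else 0)"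
      unfolding H_def sum_subtractf[symmetric]
      by (intro sum.cong refl) (simp add: algebra_simps)
    moreover have "(\<Sum>j\<in>UNIV. if j = i then of_real (q u) * u $ i else 0) = of_real (q u) * u $ i"
      by (simp only: sum.delta finite_class.finite_UNIV UNIV_I if_True)
    ultimately show ?thesis
      using ker[of i] by simp
  qed
  moreover have "\<exists>i. u $ i \<noteq> 0" 
  proof (rule ccontr)
    assume "\<not> (\<exists>i. u $ i \<noteq> 0)"
    hence "u = 0" by (simp add: vec_eq_iff)
    thus False using u(1) by simp
  qed
  ultimately have "q u \<in> real_eigenvalues G"
    unfolding real_eigenvalues_def by blast
  hence "c \<le> q u" by (rule bound)
  hence "c * (\<Sum>i\<in>UNIV. (norm (v i))\<^sup>2) \<le> q u * (\<Sum>i\<in>UNIV. (norm (v i))\<^sup>2)"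
    by (intro mult_right_mono sum_nonneg) auto
  also have "\<dots> \<le> Re (herm_form G v v)"
    using ge[of "\<chi> i. v i"] by (simp add: norm_sq q_def vec_lambda_inverse)
  finally show ?thesis .
qed

section \<open>Eigenvalues of Hermitian block Toeplitz matrices\<close>

text \<open>Unnormalised, so powers of \<open>2 * pi\<close> appear in the eigenvalue equations
  below. The integral runs over the whole space; it is a Fourier coefficient on the torus for
  functions that vanish almost everywhere outside.\<close>

definition fcoeff :: "(real^'d::finite \<Rightarrow> complex) \<Rightarrow> ('d \<Rightarrow> int) \<Rightarrow> complex" where
  "fcoeff g k = (LINT \<theta>|lborel. g \<theta> * tchar (\<lambda>j. - k j) \<theta>)"

lemma pairS_uminus: "pairS S (\<lambda>j. - k j) \<theta> = - pairS S k \<theta>"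
  by (simp add: pairS_def sum_negf)

lemma integrable_tchar:
  "integrable lborel g \<Longrightarrow> integrable lborel (\<lambda>\<theta>. g \<theta> * tchar k \<theta>)"
  by (rule integrable_mult_bounded[of _ _ 1]) auto

text \<open>Conjugation turns the character into its inverse, and substituting the negative variable
  turns it back. This is the source of the negated arguments in the lower row of
  \<open>Gsym\<close>.\<close>

lemma fcoeff_cnj_reflect:
  assumes "integrable lborel g"
  shows "fcoeff (\<lambda>\<theta>. cnj (g (- \<theta>))) k = cnj (fcoeff g k)"
proof -
  have i: "integrable lborel (\<lambda>\<theta>. cnj (g \<theta>))" using assms by simp
  have "fcoeff (\<lambda>\<theta>. cnj (g (- \<theta>))) k = (LINT \<theta>|lborel. (\<lambda>\<theta>. cnj (g \<theta>) * tchar k \<theta>) (reflS UNIV \<theta>))"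
    by (simp add: fcoeff_def reflS_UNIV pairS_def sum_negf)
  also have "\<dots> = (LINT \<theta>|lborel. cnj (g \<theta>) * tchar k \<theta>)"
    by (rule integral_reflS(2)) (rule integrable_tchar[OF i])
  also have "\<dots> = (LINT \<theta>|lborel. cnj (g \<theta> * tchar (\<lambda>j. - k j) \<theta>))"
    by (simp add: pairS_uminus cis_cnj)
  also have "\<dots> = cnj (fcoeff g k)" unfolding fcoeff_def by (rule Bochner_Integration.integral_cnj)
  finally show ?thesis .
qed

lemma fcoeff_eq_imp_AE_eq:
  assumes f: "integrable lborel f" and g: "integrable lborel g"
    and supp: "AE \<theta> in lborel. \<theta> \<notin> torus \<longrightarrow> f \<theta> = 0 \<and> g \<theta> = 0"
    and eq: "\<And>k. fcoeff f k = fcoeff g k"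
  shows "AE \<theta> in lborel. f \<theta> = g \<theta>"
proof -
  \<comment> \<open>The uniqueness result asks for vanishing at every point off the torus, while
    \<open>supp\<close> gives it only almost everywhere; the cut-off bridges the two.\<close>
  define h where "h \<theta> = indicator torus \<theta> *\<^sub>R (f \<theta> - g \<theta>)" for \<theta>
  have "integrable lborel (\<lambda>\<theta>. f \<theta> - g \<theta>)" using f g by simp
  hence h: "integrable lborel h"
    unfolding h_def by (rule integrable_mult_indicator[rotated]) simp
  have ae: "AE \<theta> in lborel. h \<theta> = f \<theta> - g \<theta>"
    using supp by eventually_elim (auto simp: h_def indicator_def)
  have [measurable]: "f \<in> borel_measurable borel" "g \<in> borel_measurable borel" "h \<in> borel_measurable borel"
    using f g h by (auto dest: borel_measurable_integrable)
  have zero: "(LINT \<theta>|lborel. h \<theta> * tchar k \<theta>) = 0" for k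
  proof -
    have "(LINT \<theta>|lborel. h \<theta> * tchar k \<theta>) = (LINT \<theta>|lborel. f \<theta> * tchar k \<theta> - g \<theta> * tchar k \<theta>)"
    proof (rule integral_cong_AE)
      show "AE \<theta> in lborel. h \<theta> * tchar k \<theta> = f \<theta> * tchar k \<theta> - g \<theta> * tchar k \<theta>"
        using ae by eventually_elim (simp add: left_diff_distrib)
    qed measurable
    also have "\<dots> = (LINT \<theta>|lborel. f \<theta> * tchar k \<theta>) - (LINT \<theta>|lborel. g \<theta> * tchar k \<theta>)"
      by (intro Bochner_Integration.integral_diff integrable_tchar f g)
    also have "\<dots> = 0" using eq[of "\<lambda>j. - k j"] by (simp add: fcoeff_def)
    finally show ?thesis .
  qed
  have "AE \<theta> in lborel. h \<theta> = 0"
    by (rule fourier_uniqueness[OF h _ zero]) (simp add: h_def)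
  with ae show ?thesis by eventually_elim simp
qed

lemma finite_Lambda: "finite (Lambda (n :: 'd::finite \<Rightarrow> nat))"
proof (rule finite_subset)
  show "Lambda n \<subseteq> Pi\<^sub>E UNIV (\<lambda>j. {..<n j})" by (auto simp: Lambda_def PiE_def)
qed (auto intro: finite_PiE)

section \<open>Toeplitz forms as integrals of vector-valued trigonometric polynomials\<close>

definition idiff :: "('d \<Rightarrow> nat) \<Rightarrow> ('d \<Rightarrow> nat) \<Rightarrow> 'd \<Rightarrow> int" where
  "idiff \<alpha> \<beta> j = int (\<alpha> j) - int (\<beta> j)"

context
  fixes A :: "('d::finite \<Rightarrow> nat) set" and y :: "('d \<Rightarrow> nat) \<Rightarrow> 'i::finite \<Rightarrow> complex"
    and P :: "real^'d \<Rightarrow> 'i \<Rightarrow> complex"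
  assumes A: "finite A"
    and P_def: "\<And>\<theta> i. P \<theta> i = (\<Sum>\<alpha>\<in>A. y \<alpha> i * tchar (\<lambda>j. int (\<alpha> j)) \<theta>)"
begin

text \<open>The conjugate character of \<open>\<alpha>\<close> times the character of
  \<open>\<beta>\<close> has frequency \<open>\<beta>\<close> minus \<open>\<alpha>\<close>, which
  is exactly the kernel of \<open>fcoeff\<close> at \<open>idiff \<alpha> \<beta>\<close>.
  Integration therefore produces Toeplitz entries.\<close>

lemma cnj_P_mult_P:
  "cnj (P \<theta> i) * z * P \<theta> j =
     (\<Sum>\<alpha>\<in>A. \<Sum>\<beta>\<in>A. cnj (y \<alpha> i) * y \<beta> j * (z * tchar (\<lambda>j. - idiff \<alpha> \<beta> j) \<theta>))"
proof -
  have "cnj (tchar (\<lambda>j. int (\<alpha> j)) \<theta>) * tchar (\<lambda>j. int (\<beta> j)) \<theta> = tchar (\<lambda>j. - idiff \<alpha> \<beta> j) \<theta>" for \<alpha> \<beta>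
    by (simp add: cis_cnj cis_mult pairS_def idiff_def algebra_simps sum_subtractf)
  moreover have "cnj (a * b) * z * (c * d) = cnj a * c * (z * (cnj b * d))" for a b c d
    by (simp add: mult_ac)
  ultimately have *: "cnj (y \<alpha> i * tchar (\<lambda>j. int (\<alpha> j)) \<theta>) * z * (y \<beta> j * tchar (\<lambda>j. int (\<beta> j)) \<theta>) =
      cnj (y \<alpha> i) * y \<beta> j * (z * tchar (\<lambda>j. - idiff \<alpha> \<beta> j) \<theta>)" for \<alpha> \<beta>
    by (simp only:)
  have "cnj (P \<theta> i) * z * P \<theta> j =
      (\<Sum>\<alpha>\<in>A. \<Sum>\<beta>\<in>A. cnj (y \<alpha> i * tchar (\<lambda>j. int (\<alpha> j)) \<theta>) * z * (y \<beta> j * tchar (\<lambda>j. int (\<beta> j)) \<theta>))"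
    unfolding P_def cnj_sum sum_distrib_right by (simp only: sum_distrib_left)
  thus ?thesis by (simp only: *)
qed

lemma integral_cnj_P_mult_P:
  assumes "integrable lborel g"
  shows "integrable lborel (\<lambda>\<theta>. cnj (P \<theta> i) * g \<theta> * P \<theta> j)"
    and "(LINT \<theta>|lborel. cnj (P \<theta> i) * g \<theta> * P \<theta> j) =
      (\<Sum>\<alpha>\<in>A. \<Sum>\<beta>\<in>A. cnj (y \<alpha> i) * y \<beta> j * fcoeff g (idiff \<alpha> \<beta>))"
  unfolding cnj_P_mult_P fcoeff_def
  by (auto simp: integrable_tchar[OF assms] Bochner_Integration.integral_sum
      intro!: Bochner_Integration.integrable_sum integrable_mult_right)

text \<open>Parseval as the special case of the Toeplitz form whose symbol is the indicator of the
  torus: its coefficients vanish except at frequency 0. The computation passes through complex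
  numbers because that form is complex valued.\<close>

lemma integral_norm_P:
  "(LINT \<theta>|lborel. indicator torus \<theta> * (norm (P \<theta> i))\<^sup>2) = (2 * pi) ^ CARD('d) * (\<Sum>\<alpha>\<in>A. (norm (y \<alpha> i))\<^sup>2)"
  and integrable_norm_P: "integrable lborel (\<lambda>\<theta>. indicator torus \<theta> * (norm (P \<theta> i))\<^sup>2)"
proof -
  have "emeasure lborel (torus :: (real^'d) set) \<le> emeasure lborel (cbox (\<chi> j. - pi) (\<chi> j. pi) :: (real^'d) set)"
    by (intro emeasure_mono) (auto simp: torus_def mem_box_cart less_imp_le)
  hence "emeasure lborel (torus :: (real^'d) set) < \<infinity>"
    using emeasure_lborel_cbox_finite le_less_trans by blast
  hence "integrable lborel (indicator torus :: real^'d \<Rightarrow> real)"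
    by (intro integrable_real_indicator) auto
  hence "integrable lborel (\<lambda>\<theta>::real^'d. complex_of_real (indicator torus \<theta>))"
    by (rule integrable_of_real)
  hence iT: "integrable lborel (indicator torus :: real^'d \<Rightarrow> complex)"
    by (rule Bochner_Integration.integrable_cong[THEN iffD1, rotated -1]) (auto simp: indicator_def)
  have eq: "complex_of_real (indicator torus \<theta> * (norm (P \<theta> i))\<^sup>2) = cnj (P \<theta> i) * indicator torus \<theta> * P \<theta> i" for \<theta>
    using complex_norm_square[of "P \<theta> i"] by (auto simp: indicator_def mult.commute)
  have "integrable lborel (\<lambda>\<theta>. complex_of_real (indicator torus \<theta> * (norm (P \<theta> i))\<^sup>2))"
    unfolding eq by (rule integral_cnj_P_mult_P(1)[OF iT])
  thus "integrable lborel (\<lambda>\<theta>. indicator torus \<theta> * (norm (P \<theta> i))\<^sup>2)"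
    using complex_of_real_integrable_eq by blast
  have "complex_of_real (LINT \<theta>|lborel. indicator torus \<theta> * (norm (P \<theta> i))\<^sup>2) =
      (LINT \<theta>|lborel. complex_of_real (indicator torus \<theta> * (norm (P \<theta> i))\<^sup>2))"
    by (rule integral_complex_of_real[symmetric])
  also have "\<dots> = (\<Sum>\<alpha>\<in>A. \<Sum>\<beta>\<in>A. cnj (y \<alpha> i) * y \<beta> i * fcoeff (indicator torus) (idiff \<alpha> \<beta>))"
    unfolding eq by (rule integral_cnj_P_mult_P(2)[OF iT])
  also have "\<dots> = (\<Sum>\<alpha>\<in>A. \<Sum>\<beta>\<in>A. if \<beta> = \<alpha> then cnj (y \<alpha> i) * y \<alpha> i * (2 * pi) ^ CARD('d) else 0)"
  proof (intro sum.cong refl)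
    fix \<alpha> \<beta> :: "'d \<Rightarrow> nat"
    have "(\<forall>j. - idiff \<alpha> \<beta> j = 0) \<longleftrightarrow> \<beta> = \<alpha>" by (auto simp: idiff_def fun_eq_iff)
    hence "fcoeff (indicator torus) (idiff \<alpha> \<beta>) = (if \<beta> = \<alpha> then (2 * pi) ^ CARD('d) else 0)"
      unfolding fcoeff_def integral_torus_tchar by simp
    thus "cnj (y \<alpha> i) * y \<beta> i * fcoeff (indicator torus) (idiff \<alpha> \<beta>) =
        (if \<beta> = \<alpha> then cnj (y \<alpha> i) * y \<alpha> i * (2 * pi) ^ CARD('d) else 0)" by simp
  qed
  also have "\<dots> = (\<Sum>\<alpha>\<in>A. cnj (y \<alpha> i) * y \<alpha> i * (2 * pi) ^ CARD('d))"
    using A by (intro sum.cong refl) (simp only: sum.delta if_True)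
  also have "\<dots> = (\<Sum>\<alpha>\<in>A. complex_of_real ((2 * pi) ^ CARD('d) * (norm (y \<alpha> i))\<^sup>2))"
    by (intro sum.cong refl, subst of_real_mult, subst complex_norm_square) (simp add: mult_ac)
  also have "\<dots> = complex_of_real ((2 * pi) ^ CARD('d) * (\<Sum>\<alpha>\<in>A. (norm (y \<alpha> i))\<^sup>2))"
    by (simp only: of_real_sum sum_distrib_left)
  finally show "(LINT \<theta>|lborel. indicator torus \<theta> * (norm (P \<theta> i))\<^sup>2) = (2 * pi) ^ CARD('d) * (\<Sum>\<alpha>\<in>A. (norm (y \<alpha> i))\<^sup>2)"
    by (simp only: of_real_eq_iff)
qed

end

text \<open>The symbol \<open>G\<close> is left arbitrary so that the upper bound can be had from
  the negated symbol with \<open>- r\<close>. The factor \<open>(2 * pi) ^ CARD('d)\<close> enters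
  through the unnormalised \<open>fcoeff\<close> and again through Parseval, and cancels at the
  end.\<close>

lemma toeplitz_eigenvalue_lower_bound:
  fixes G :: "real^'d::finite \<Rightarrow> 'i::finite \<Rightarrow> 'i \<Rightarrow> complex"
  assumes int: "\<And>i j. integrable lborel (\<lambda>\<theta>. G \<theta> i j)"
    and supp: "AE \<theta> in lborel. \<theta> \<notin> torus \<longrightarrow> (\<forall>i j. G \<theta> i j = 0)"
    and herm: "AE \<theta> in lborel. \<forall>i j. G \<theta> i j = cnj (G \<theta> j i)"
    and bound: "AE \<theta> in lborel. \<theta> \<in> torus \<longrightarrow> ereal c \<le> lambda_min (G \<theta>)"
    and A: "finite A"
    and nz: "\<exists>\<alpha>\<in>A. \<exists>i. y \<alpha> i \<noteq> 0"
    and eig: "\<And>\<alpha> i. \<alpha> \<in> A \<Longrightarrow>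
      (\<Sum>\<beta>\<in>A. \<Sum>j\<in>UNIV. fcoeff (\<lambda>\<theta>. G \<theta> i j) (idiff \<alpha> \<beta>) * y \<beta> j) = of_real ((2 * pi) ^ CARD('d) * r) * y \<alpha> i"
  shows "c \<le> r"
proof -
  define P where "P \<theta> i = (\<Sum>\<alpha>\<in>A. y \<alpha> i * tchar (\<lambda>j. int (\<alpha> j)) \<theta>)" for \<theta> i
  define N where "N = (\<Sum>i\<in>UNIV. \<Sum>\<alpha>\<in>A. (norm (y \<alpha> i))\<^sup>2)"
  define V where "V = (2 * pi) ^ CARD('d)"
  have V: "V > 0" by (simp add: V_def)
  note PP = integral_cnj_P_mult_P[OF A P_def int] and NP = integral_norm_P[OF A P_def] integrable_norm_P[OF A P_def]
  have hf: "herm_form (G \<theta>) (P \<theta>) (P \<theta>) = (\<Sum>i\<in>UNIV. \<Sum>j\<in>UNIV. cnj (P \<theta> i) * G \<theta> i j * P \<theta> j)" for \<theta>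
    by (simp add: herm_form_def)
  have hf_int: "integrable lborel (\<lambda>\<theta>. herm_form (G \<theta>) (P \<theta>) (P \<theta>))"
    unfolding hf by (intro Bochner_Integration.integrable_sum PP)
  have "(LINT \<theta>|lborel. herm_form (G \<theta>) (P \<theta>) (P \<theta>)) =
      (\<Sum>i\<in>UNIV. \<Sum>j\<in>UNIV. \<Sum>\<alpha>\<in>A. \<Sum>\<beta>\<in>A. cnj (y \<alpha> i) * y \<beta> j * fcoeff (\<lambda>\<theta>. G \<theta> i j) (idiff \<alpha> \<beta>))"
  proof -
    have "(LINT \<theta>|lborel. herm_form (G \<theta>) (P \<theta>) (P \<theta>)) =
        (\<Sum>i\<in>UNIV. (LINT \<theta>|lborel. (\<Sum>j\<in>UNIV. cnj (P \<theta> i) * G \<theta> i j * P \<theta> j)))"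
      unfolding hf by (intro Bochner_Integration.integral_sum Bochner_Integration.integrable_sum PP)
    also have "\<dots> = (\<Sum>i\<in>UNIV. \<Sum>j\<in>UNIV. (LINT \<theta>|lborel. cnj (P \<theta> i) * G \<theta> i j * P \<theta> j))"
      by (intro sum.cong refl Bochner_Integration.integral_sum PP)
    also have "\<dots> = (\<Sum>i\<in>UNIV. \<Sum>j\<in>UNIV. \<Sum>\<alpha>\<in>A. \<Sum>\<beta>\<in>A. cnj (y \<alpha> i) * y \<beta> j * fcoeff (\<lambda>\<theta>. G \<theta> i j) (idiff \<alpha> \<beta>))"
      by (intro sum.cong refl PP(2))
    finally show ?thesis .
  qed
  \<comment> \<open>Reordering exposes the matrix-vector product, to which \<open>eig\<close>
    applies.\<close>
  also have "\<dots> = (\<Sum>i\<in>UNIV. \<Sum>\<alpha>\<in>A. cnj (y \<alpha> i) * (\<Sum>\<beta>\<in>A. \<Sum>j\<in>UNIV. fcoeff (\<lambda>\<theta>. G \<theta> i j) (idiff \<alpha> \<beta>) * y \<beta> j))"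
  proof (intro sum.cong refl)
    fix i
    have "(\<Sum>j\<in>UNIV. \<Sum>\<alpha>\<in>A. \<Sum>\<beta>\<in>A. cnj (y \<alpha> i) * y \<beta> j * fcoeff (\<lambda>\<theta>. G \<theta> i j) (idiff \<alpha> \<beta>)) =
        (\<Sum>\<alpha>\<in>A. \<Sum>j\<in>UNIV. \<Sum>\<beta>\<in>A. cnj (y \<alpha> i) * y \<beta> j * fcoeff (\<lambda>\<theta>. G \<theta> i j) (idiff \<alpha> \<beta>))"
      by (rule sum.swap)
    also have "\<dots> = (\<Sum>\<alpha>\<in>A. \<Sum>\<beta>\<in>A. \<Sum>j\<in>UNIV. cnj (y \<alpha> i) * y \<beta> j * fcoeff (\<lambda>\<theta>. G \<theta> i j) (idiff \<alpha> \<beta>))"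
      by (intro sum.cong refl sum.swap)
    also have "\<dots> = (\<Sum>\<alpha>\<in>A. cnj (y \<alpha> i) * (\<Sum>\<beta>\<in>A. \<Sum>j\<in>UNIV. fcoeff (\<lambda>\<theta>. G \<theta> i j) (idiff \<alpha> \<beta>) * y \<beta> j))"
      unfolding sum_distrib_left by (intro sum.cong refl) (simp only: mult_ac)
    finally show "(\<Sum>j\<in>UNIV. \<Sum>\<alpha>\<in>A. \<Sum>\<beta>\<in>A. cnj (y \<alpha> i) * y \<beta> j * fcoeff (\<lambda>\<theta>. G \<theta> i j) (idiff \<alpha> \<beta>)) =
      (\<Sum>\<alpha>\<in>A. cnj (y \<alpha> i) * (\<Sum>\<beta>\<in>A. \<Sum>j\<in>UNIV. fcoeff (\<lambda>\<theta>. G \<theta> i j) (idiff \<alpha> \<beta>) * y \<beta> j))" .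
  qed
  also have "\<dots> = (\<Sum>i\<in>UNIV. \<Sum>\<alpha>\<in>A. of_real (V * r * (norm (y \<alpha> i))\<^sup>2))"
  proof (intro sum.cong refl)
    fix i \<alpha> assume "\<alpha> \<in> A"
    show "cnj (y \<alpha> i) * (\<Sum>\<beta>\<in>A. \<Sum>j\<in>UNIV. fcoeff (\<lambda>\<theta>. G \<theta> i j) (idiff \<alpha> \<beta>) * y \<beta> j) =
        of_real (V * r * (norm (y \<alpha> i))\<^sup>2)"
      unfolding eig[OF \<open>\<alpha> \<in> A\<close>] V_def[symmetric]
      by (simp only: of_real_mult complex_norm_square mult_ac)
  qed
  also have "\<dots> = of_real (V * r * N)"
    by (simp only: N_def of_real_sum sum_distrib_left)
  finally have I: "(LINT \<theta>|lborel. herm_form (G \<theta>) (P \<theta>) (P \<theta>)) = of_real (V * r * N)" .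
  \<comment> \<open>The indicator on the left matters off the torus: there \<open>G\<close> vanishes
    almost everywhere, but \<open>P\<close> in general does not.\<close>
  have "(LINT \<theta>|lborel. c * (\<Sum>i\<in>UNIV. indicator torus \<theta> * (norm (P \<theta> i))\<^sup>2)) \<le>
      (LINT \<theta>|lborel. Re (herm_form (G \<theta>) (P \<theta>) (P \<theta>)))"
  proof (rule integral_mono_AE)
    show "integrable lborel (\<lambda>\<theta>. c * (\<Sum>i\<in>UNIV. indicator torus \<theta> * (norm (P \<theta> i))\<^sup>2))"
      by (intro integrable_mult_right Bochner_Integration.integrable_sum NP)
    show "integrable lborel (\<lambda>\<theta>. Re (herm_form (G \<theta>) (P \<theta>) (P \<theta>)))"
      using hf_int by (rule integrable_Re)
    show "AE \<theta> in lborel. c * (\<Sum>i\<in>UNIV. indicator torus \<theta> * (norm (P \<theta> i))\<^sup>2) \<le> Re (herm_form (G \<theta>) (P \<theta>) (P \<theta>))"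
      using supp herm bound
    proof eventually_elim
      case (elim \<theta>)
      show ?case
      proof (cases "\<theta> \<in> torus")
        case True
        have le: "c \<le> x" if "x \<in> real_eigenvalues (G \<theta>)" for x
        proof -
          have "lambda_min (G \<theta>) \<le> ereal x"
            unfolding lambda_min_def by (rule Inf_lower) (use that in blast)
          hence "ereal c \<le> ereal x" using elim(3) True order_trans by blast
          thus ?thesis by simp
        qed
        have "c * (\<Sum>i\<in>UNIV. (norm (P \<theta> i))\<^sup>2) \<le> Re (herm_form (G \<theta>) (P \<theta>) (P \<theta>))"
          by (rule hermitian_form_ge_eigenvalue_bound[OF elim(2)[rule_format] le])
        thus ?thesis using True by simp
      next
        case False
        thus ?thesis using elim(1) by (simp add: herm_form_def)
      qed
    qed
  qed
  also have "(LINT \<theta>|lborel. c * (\<Sum>i\<in>UNIV. indicator torus \<theta> * (norm (P \<theta> i))\<^sup>2)) = c * (V * N)"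
  proof -
    have "(LINT \<theta>|lborel. c * (\<Sum>i\<in>UNIV. indicator torus \<theta> * (norm (P \<theta> i))\<^sup>2)) =
        c * (LINT \<theta>|lborel. (\<Sum>i\<in>UNIV. indicator torus \<theta> * (norm (P \<theta> i))\<^sup>2))"
      by (rule integral_mult_right_zero)
    also have "(LINT \<theta>|lborel. (\<Sum>i\<in>UNIV. indicator torus \<theta> * (norm (P \<theta> i))\<^sup>2)) =
        (\<Sum>i\<in>UNIV. (LINT \<theta>|lborel. indicator torus \<theta> * (norm (P \<theta> i))\<^sup>2))"
      by (intro Bochner_Integration.integral_sum NP)
    also have "\<dots> = V * N"
      unfolding N_def V_def sum_distrib_left[of _ _ UNIV] by (intro sum.cong refl NP(1))
    finally show ?thesis .
  qed
  also have "(LINT \<theta>|lborel. Re (herm_form (G \<theta>) (P \<theta>) (P \<theta>))) = V * r * N"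
    using hf_int I by (simp del: of_real_mult)
  finally have "c * (V * N) \<le> r * (V * N)" by (simp only: mult_ac)
  moreover have "N > 0"
  proof -
    obtain \<alpha> i where "\<alpha> \<in> A" "y \<alpha> i \<noteq> 0" using nz by blast
    hence "0 < (\<Sum>\<alpha>\<in>A. (norm (y \<alpha> i))\<^sup>2)"
      using A by (intro sum_pos2[of _ \<alpha>]) auto
    thus ?thesis unfolding N_def by (intro sum_pos2[of _ i]) (auto intro: sum_nonneg)
  qed
  ultimately show "c \<le> r" using V by simp
qed

section \<open>Quaternion matrices\<close>

lemma qmult_assoc: "qmult (qmult p q) r = qmult p (qmult q r)"
  by (simp add: qmult_def algebra_simps)

lemma qmult_sum_right: "qmult p (\<Sum>i\<in>I. f i) = (\<Sum>i\<in>I. qmult p (f i))"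
  by (simp add: qmult_def prod_eq_iff fst_sum snd_sum sum_distrib_left sum_subtractf sum.distrib)

lemma qmult_sum_left: "qmult (\<Sum>i\<in>I. f i) p = (\<Sum>i\<in>I. qmult (f i) p)"
  by (simp add: qmult_def prod_eq_iff fst_sum snd_sum sum_distrib_right sum_subtractf sum.distrib)

lemma qconj_sum: "qconj (\<Sum>i\<in>I. f i) = (\<Sum>i\<in>I. qconj (f i))"
  by (simp add: qconj_def prod_eq_iff fst_sum snd_sum sum_negf)

lemma qconj_qmult: "qconj (qmult p q) = qmult (qconj q) (qconj p)"
  by (simp add: qmult_def qconj_def algebra_simps)

lemma qconj_qconj: "qconj (qconj p) = p"
  by (simp add: qconj_def)

lemma qmult_qconj_self: "qmult (qconj p) p = qofreal ((norm (fst p))\<^sup>2 + (norm (snd p))\<^sup>2)"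
  unfolding qofreal_def of_real_add complex_norm_square by (simp add: qmult_def qconj_def mult.commute)

text \<open>Pairing the eigenvalue equation with the conjugate of \<open>x\<close> from the left
  gives \<open>Q\<close>, the positive real \<open>N\<close> times \<open>lam\<close>, with
  \<open>lam\<close> staying on the right. Hermitian symmetry makes \<open>Q\<close> self-conjugate,
  and only real quaternions are.\<close>

lemma qright_eigenvalue_hermitian_real:
  assumes herm: "qhermitian I A" and I: "finite I"
    and nz: "\<exists>p\<in>I. x p \<noteq> 0"
    and eig: "\<And>p. p \<in> I \<Longrightarrow> (\<Sum>q\<in>I. qmult (A p q) (x q)) = qmult (x p) lam"
  shows "\<exists>r. lam = qofreal r"
proof -
  define N where "N = (\<Sum>p\<in>I. (norm (fst (x p)))\<^sup>2 + (norm (snd (x p)))\<^sup>2)"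
  define Q where "Q = (\<Sum>p\<in>I. \<Sum>q\<in>I. qmult (qconj (x p)) (qmult (A p q) (x q)))"
  have "Q = (\<Sum>p\<in>I. qmult (qconj (x p)) (qmult (x p) lam))"
    unfolding Q_def by (intro sum.cong refl) (simp add: eig flip: qmult_sum_right)
  also have "\<dots> = qmult (\<Sum>p\<in>I. qmult (qconj (x p)) (x p)) lam"
    by (simp add: qmult_sum_left qmult_assoc)
  also have "(\<Sum>p\<in>I. qmult (qconj (x p)) (x p)) = qofreal N"
    by (simp add: qmult_qconj_self N_def qofreal_def prod_eq_iff fst_sum snd_sum)
  finally have Q: "Q = qmult (qofreal N) lam" .
  have "qconj Q = (\<Sum>p\<in>I. \<Sum>q\<in>I. qmult (qconj (x q)) (qmult (qconj (A p q)) (x p)))"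
    by (simp add: Q_def qconj_sum qconj_qmult qconj_qconj qmult_assoc)
  also have "\<dots> = (\<Sum>p\<in>I. \<Sum>q\<in>I. qmult (qconj (x q)) (qmult (A q p) (x p)))"
  proof (intro sum.cong refl)
    fix p q assume "p \<in> I" "q \<in> I"
    hence "A q p = qconj (A p q)" using herm unfolding qhermitian_def by blast
    thus "qmult (qconj (x q)) (qmult (qconj (A p q)) (x p)) = qmult (qconj (x q)) (qmult (A q p) (x p))"
      by (simp only:)
  qed
  also have "\<dots> = Q" unfolding Q_def by (rule sum.swap)
  finally have QQ: "qconj Q = Q" .
  have "N > 0"
  proof -
    obtain p where p: "p \<in> I" "x p \<noteq> 0" using nz by blast
    hence "0 < (norm (fst (x p)))\<^sup>2 + (norm (snd (x p)))\<^sup>2"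
      by (auto simp: prod_eq_iff add_pos_nonneg add_nonneg_pos)
    thus ?thesis unfolding N_def using I p(1) by (intro sum_pos2[of _ p]) auto
  qed
  hence "cnj (fst lam) = fst lam" "snd lam = 0"
    using QQ unfolding Q by (auto simp: qconj_def qmult_def qofreal_def complex_eq_iff)
  hence "lam = qofreal (Re (fst lam))"
    by (auto simp: qofreal_def prod_eq_iff complex_eq_iff)
  thus ?thesis by blast
qed

text \<open>Projections commute with the integral only once the pair is known to be integrable; this
  comes from writing it as a sum of two embedded components.\<close>

lemma integral_Pair:
  fixes f g :: "'b \<Rightarrow> complex"
  assumes "integrable M f" "integrable M g"
  shows "(LINT x|M. (f x, g x)) = (LINT x|M. f x, LINT x|M. g x)"
proof -
  have "bounded_linear (\<lambda>z::complex. (z, 0::complex))" "bounded_linear (\<lambda>z::complex. (0::complex, z))"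
    by (auto intro!: bounded_linear_Pair bounded_linear_ident bounded_linear_zero)
  note * = integrable_bounded_linear[OF this(1) assms(1)] integrable_bounded_linear[OF this(2) assms(2)]
  have "integrable M (\<lambda>x. (f x, 0) + (0, g x))"
    by (intro Bochner_Integration.integrable_add *)
  hence i: "integrable M (\<lambda>x. (f x, g x))" by simp
  show ?thesis
    using integral_bounded_linear[OF bounded_linear_fst i] integral_bounded_linear[OF bounded_linear_snd i]
    by (simp add: prod_eq_iff)
qed

lemma pairS_UNIV_split: "pairS UNIV k \<theta> = pairS S k \<theta> + pairS (- S) k \<theta>"
  unfolding pairS_def using sum.union_disjoint[of S "- S" "\<lambda>j. real_of_int (k j) * \<theta> $ j"]
  by (simp add: Compl_partition)

text \<open>Right-hand phases change sign on being moved past j. The resulting difference of phases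
  is here an ordinary full phase at a reflected point.\<close>

lemma pairS_reflS: "pairS UNIV k (reflS (- S) \<theta>) = pairS S k \<theta> - pairS (- S) k \<theta>"
proof -
  have "pairS S k (reflS (- S) \<theta>) = pairS S k \<theta>"
    unfolding pairS_def by (intro sum.cong) (auto simp: reflS_def)
  moreover have "pairS (- S) k (reflS (- S) \<theta>) = - pairS (- S) k \<theta>"
    unfolding pairS_def sum_negf[symmetric] by (intro sum.cong) (auto simp: reflS_def)
  ultimately show ?thesis by (simp add: pairS_UNIV_split[of k _ S])
qed

lemma fcoeff_uminus: "fcoeff (\<lambda>\<theta>. - g \<theta>) k = - fcoeff g k"
  by (simp add: fcoeff_def)

lemma real_eigenvalues_uminus: "x \<in> real_eigenvalues (\<lambda>i j. - G i j) \<longleftrightarrow> - x \<in> real_eigenvalues G"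
proof -
  have "- a = b \<longleftrightarrow> a = - b" for a b :: complex by auto
  thus ?thesis by (simp add: real_eigenvalues_def sum_negf)
qed

section \<open>The complex symbol of a quaternion-valued function\<close>

locale toeplitz_symbol =
  fixes Z W :: "real^'d::finite \<Rightarrow> 'a::finite \<Rightarrow> 'a \<Rightarrow> complex"
    and SL :: "'d set"
  assumes L1Z: "\<And>a b. set_integrable lborel torus (\<lambda>\<theta>. Z \<theta> a b)"
    and L1W: "\<And>a b. set_integrable lborel torus (\<lambda>\<theta>. W \<theta> a b)"
begin

text \<open>
  Cutting off outside the torus loses nothing almost everywhere, but is needed for measurability:
  reflections move part of the boundary of $[-\pi,\pi)^d$ out of the torus, where \<open>Z\<close> and \<open>W\<close>
  are arbitrary.
\<close>

definition Zt where "Zt \<theta> a b = indicator torus \<theta> *\<^sub>R Z \<theta> a b"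
definition Wt where "Wt \<theta> a b = indicator torus \<theta> *\<^sub>R W \<theta> a b"
definition Vt where "Vt \<theta> a b = Wt (reflS (- SL) \<theta>) a b"
definition G where "G = Gsym SL Zt Wt"

lemma integrable_Zt: "integrable lborel (\<lambda>\<theta>. Zt \<theta> a b)"
  using L1Z by (simp add: Zt_def set_integrable_def)

lemma integrable_Wt: "integrable lborel (\<lambda>\<theta>. Wt \<theta> a b)"
  using L1W by (simp add: Wt_def set_integrable_def)

lemma integrable_Vt: "integrable lborel (\<lambda>\<theta>. Vt \<theta> a b)"
  unfolding Vt_def by (rule integral_reflS(1)[OF integrable_Wt])

text \<open>Reflecting the negated variable in \<open>SL\<close> is reflecting the variable in the
  complement, so \<open>Vt\<close> serves both off-diagonal blocks. The lower row becomes the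
  conjugate of the upper one at the negated variable, in the shape that
  \<open>fcoeff_cnj_reflect\<close> expects.\<close>

lemma G_simps:
  "G \<theta> (Inl a) (Inl b) = Zt \<theta> a b"
  "G \<theta> (Inl a) (Inr b) = Vt \<theta> a b"
  "G \<theta> (Inr a) (Inl b) = - cnj (Vt (- \<theta>) a b)"
  "G \<theta> (Inr a) (Inr b) = cnj (Zt (- \<theta>) a b)"
  by (simp_all add: G_def Gsym_def Vt_def reflS_uminus)

lemma integrable_G: "integrable lborel (\<lambda>\<theta>. G \<theta> i j)"
  by (cases i; cases j) (auto simp: G_simps integrable_Zt integrable_Vt
    integral_reflS(1)[OF integrable_Zt, where S = UNIV, unfolded reflS_UNIV]
    integral_reflS(1)[OF integrable_Vt, where S = UNIV, unfolded reflS_UNIV])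

text \<open>At each frequency the four blocks form the complex matrix of the single quaternion
  matrix z + v j, where z and v are the coefficients of \<open>Zt\<close> and
  \<open>Vt\<close>.\<close>

lemma fcoeff_G:
  "fcoeff (\<lambda>\<theta>. G \<theta> (Inl a) (Inl b)) k = fcoeff (\<lambda>\<theta>. Zt \<theta> a b) k"
  "fcoeff (\<lambda>\<theta>. G \<theta> (Inl a) (Inr b)) k = fcoeff (\<lambda>\<theta>. Vt \<theta> a b) k"
  "fcoeff (\<lambda>\<theta>. G \<theta> (Inr a) (Inl b)) k = - cnj (fcoeff (\<lambda>\<theta>. Vt \<theta> a b) k)"
  "fcoeff (\<lambda>\<theta>. G \<theta> (Inr a) (Inr b)) k = cnj (fcoeff (\<lambda>\<theta>. Zt \<theta> a b) k)"
  by (simp_all add: G_simps fcoeff_uminus fcoeff_cnj_reflect[OF integrable_Vt] fcoeff_cnj_reflect[OF integrable_Zt])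

text \<open>Outside the null set on which a reflection crosses the boundary, the cut-off commutes
  with the reflections. Essential bounds for \<open>Gsym SL Z W\<close> thus carry over to
  \<open>G\<close>.\<close>

lemma AE_G: "AE \<theta> in lborel. (\<theta> \<notin> torus \<longrightarrow> (\<forall>i j. G \<theta> i j = 0)) \<and> (\<theta> \<in> torus \<longrightarrow> G \<theta> = Gsym SL Z W \<theta>)"
  using AE_reflS_torus
proof eventually_elim
  case (elim \<theta>)
  have refl: "reflS S \<theta> \<in> torus \<longleftrightarrow> \<theta> \<in> torus" "- \<theta> \<in> torus \<longleftrightarrow> \<theta> \<in> torus"
    "reflS S (- \<theta>) \<in> torus \<longleftrightarrow> \<theta> \<in> torus" for S
    using elim elim[rule_format, of UNIV] by (simp_all add: reflS_uminus reflS_UNIV)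
  show ?case
    by (auto simp: G_def Gsym_def Zt_def Wt_def refl fun_eq_iff split: sum.splits)
qed

text \<open>On the \<open>Z\<close> component the two phases commute with the entry and merge into
  one character. On the \<open>W\<close> component the right phase arrives conjugated, leaving
  \<open>h\<close>; substituting the reflection of the right-hand variables turns \<open>h\<close>
  into a character and \<open>Wt\<close> into \<open>Vt\<close>.\<close>

lemma toeplitz_entry:
  "toeplitz SL (quatF Z W) (\<alpha>, a) (\<beta>, b) = (1 / (2 * pi) ^ CARD('d)) *\<^sub>R
     (fcoeff (\<lambda>\<theta>. Zt \<theta> a b) (idiff \<alpha> \<beta>), fcoeff (\<lambda>\<theta>. Vt \<theta> a b) (idiff \<alpha> \<beta>))"
proof -
  define k where "k = idiff \<alpha> \<beta>"
  define h :: "real^'d \<Rightarrow> complex" where "h \<theta> = cis (- (pairS SL k \<theta> - pairS (- SL) k \<theta>))" for \<theta>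
  have h: "h \<theta> = tchar (\<lambda>j. - k j) (reflS (- SL) \<theta>)" for \<theta>
    by (simp add: h_def pairS_reflS pairS_uminus)
  have Wh: "integrable lborel (\<lambda>\<theta>. Wt \<theta> a b * h \<theta>)"
    by (rule integrable_mult_bounded[OF integrable_Wt, of _ 1]) (auto simp: h_def)
  have "indicator torus \<theta> *\<^sub>R qmult (qmult (qexpi (- pairS SL k \<theta>)) (quatF Z W \<theta> a b)) (qexpi (- pairS (- SL) k \<theta>)) =
      (Zt \<theta> a b * tchar (\<lambda>j. - k j) \<theta>, Wt \<theta> a b * h \<theta>)" for \<theta>
    by (simp add: qmult_def qexpi_def quatF_def Zt_def Wt_def h_def pairS_uminus pairS_UNIV_split[of _ _ SL]
        cis_mult cis_cnj mult.commute mult.left_commute)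
  hence "(LINT \<theta>:torus|lborel. qmult (qmult (qexpi (- pairS SL k \<theta>)) (quatF Z W \<theta> a b)) (qexpi (- pairS (- SL) k \<theta>)))
      = (LINT \<theta>|lborel. (Zt \<theta> a b * tchar (\<lambda>j. - k j) \<theta>, Wt \<theta> a b * h \<theta>))"
    unfolding set_lebesgue_integral_def by simp
  also have "\<dots> = (fcoeff (\<lambda>\<theta>. Zt \<theta> a b) k, LINT \<theta>|lborel. Wt \<theta> a b * h \<theta>)"
    unfolding fcoeff_def by (rule integral_Pair) (intro integrable_tchar integrable_Zt Wh)+
  also have "(LINT \<theta>|lborel. Wt \<theta> a b * h \<theta>) = (LINT \<theta>|lborel. (\<lambda>\<theta>. Wt \<theta> a b * h \<theta>) (reflS (- SL) \<theta>))"
    by (rule integral_reflS(2)[OF Wh, symmetric])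
  also have "\<dots> = fcoeff (\<lambda>\<theta>. Vt \<theta> a b) k"
    by (simp add: fcoeff_def Vt_def h reflS_reflS)
  finally show ?thesis
    unfolding toeplitz_def sandwich_coeff_def
    by (simp add: k_def idiff_def[abs_def] powr_minus powr_realpow divide_inverse)
qed

text \<open>Every frequency is a difference of two indices in a large enough box, so Hermitian
  symmetry for all sizes constrains all Fourier coefficients. Those of \<open>G\<close> and of its
  conjugate transpose then agree, and uniqueness applies entry by entry.\<close>

lemma AE_G_hermitian:
  assumes herm: "\<And>n :: 'd \<Rightarrow> nat. (\<forall>j. 1 \<le> n j) \<Longrightarrow>
                 qhermitian (toeplitz_index n) (toeplitz SL (quatF Z W))"
  shows "AE \<theta> in lborel. \<forall>i j. G \<theta> i j = cnj (G \<theta> j i)"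
proof -
  have coeff: "fcoeff (\<lambda>\<theta>. Zt \<theta> b a) (\<lambda>j. - k j) = cnj (fcoeff (\<lambda>\<theta>. Zt \<theta> a b) k)"
    "fcoeff (\<lambda>\<theta>. Vt \<theta> b a) (\<lambda>j. - k j) = - fcoeff (\<lambda>\<theta>. Vt \<theta> a b) k" for a b k
  proof -
    \<comment> \<open>Positive and negative parts of \<open>k\<close>. The box below has side
      \<open>nat \<bar>k j\<bar> + 1\<close>: indices lie strictly below the side, which must also
      be at least 1.\<close>
    define \<alpha> \<beta> where "\<alpha> j = nat (k j)" and "\<beta> j = nat (- k j)" for j
    have k: "idiff \<alpha> \<beta> = k" "idiff \<beta> \<alpha> = (\<lambda>j. - k j)"
      by (auto simp: idiff_def fun_eq_iff \<alpha>_def \<beta>_def)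
    have "qhermitian (toeplitz_index (\<lambda>j. nat \<bar>k j\<bar> + 1)) (toeplitz SL (quatF Z W))"
      by (rule herm) simp
    moreover have "(\<alpha>, a) \<in> toeplitz_index (\<lambda>j. nat \<bar>k j\<bar> + 1)" "(\<beta>, b) \<in> toeplitz_index (\<lambda>j. nat \<bar>k j\<bar> + 1)"
      by (auto simp: toeplitz_index_def Lambda_def \<alpha>_def \<beta>_def)
    ultimately have "toeplitz SL (quatF Z W) (\<beta>, b) (\<alpha>, a) = qconj (toeplitz SL (quatF Z W) (\<alpha>, a) (\<beta>, b))"
      unfolding qhermitian_def by blast
    thus "fcoeff (\<lambda>\<theta>. Zt \<theta> b a) (\<lambda>j. - k j) = cnj (fcoeff (\<lambda>\<theta>. Zt \<theta> a b) k)"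
      "fcoeff (\<lambda>\<theta>. Vt \<theta> b a) (\<lambda>j. - k j) = - fcoeff (\<lambda>\<theta>. Vt \<theta> a b) k"
      unfolding toeplitz_entry k by (simp_all add: qconj_def flip: scaleR_minus_right)
  qed
  \<comment> \<open>In the off-diagonal blocks the minus sign of the second relation in
    \<open>coeff\<close> cancels the one built into the lower left block.\<close>
  have G: "fcoeff (\<lambda>\<theta>. G \<theta> j i) (\<lambda>l. - k l) = cnj (fcoeff (\<lambda>\<theta>. G \<theta> i j) k)" for i j k
    by (cases i; cases j) (simp_all add: fcoeff_G coeff)
  have cnj_G: "fcoeff (\<lambda>\<theta>. cnj (G \<theta> j i)) k = cnj (fcoeff (\<lambda>\<theta>. G \<theta> j i) (\<lambda>l. - k l))" for i j k
  proof -
    have "fcoeff (\<lambda>\<theta>. cnj (G \<theta> j i)) k = (LINT \<theta>|lborel. cnj (G \<theta> j i * tchar (\<lambda>l. - (- k l)) \<theta>))"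
      by (simp add: fcoeff_def pairS_uminus cis_cnj)
    also have "\<dots> = cnj (fcoeff (\<lambda>\<theta>. G \<theta> j i) (\<lambda>l. - k l))"
      unfolding fcoeff_def by (rule Bochner_Integration.integral_cnj)
    finally show ?thesis .
  qed
  have "AE \<theta> in lborel. G \<theta> i j = cnj (G \<theta> j i)" for i j
  proof (rule fcoeff_eq_imp_AE_eq)
    show "AE \<theta> in lborel. \<theta> \<notin> torus \<longrightarrow> G \<theta> i j = 0 \<and> cnj (G \<theta> j i) = 0"
      using AE_G by eventually_elim simp
    show "fcoeff (\<lambda>\<theta>. G \<theta> i j) k = fcoeff (\<lambda>\<theta>. cnj (G \<theta> j i)) k" for k
      by (simp add: cnj_G G)
  qed (simp_all add: integrable_G)
  thus ?thesis by (simp add: AE_all_countable)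
qed

text \<open>A quaternion u + v j is encoded as the complex pair (u, -conj v). With this choice the
  upper rows are the complex part of the quaternion equation, and the lower rows are minus the
  conjugate of its j-part. The eigenvalue survives conjugation because \<open>r\<close> is
  real.\<close>

lemma toeplitz_eigenvector:
  assumes eig: "\<And>p. p \<in> toeplitz_index n \<Longrightarrow>
      (\<Sum>q\<in>toeplitz_index n. qmult (toeplitz SL (quatF Z W) p q) (x q)) = qmult (x p) (qofreal r)"
    and \<alpha>: "\<alpha> \<in> Lambda n"
  defines "y \<equiv> \<lambda>\<alpha> i. case i of Inl a \<Rightarrow> fst (x (\<alpha>, a)) | Inr a \<Rightarrow> - cnj (snd (x (\<alpha>, a)))"
  shows "(\<Sum>\<beta>\<in>Lambda n. \<Sum>j\<in>UNIV. fcoeff (\<lambda>\<theta>. G \<theta> i j) (idiff \<alpha> \<beta>) * y \<beta> j) =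
    of_real ((2 * pi) ^ CARD('d) * r) * y \<alpha> i"
proof -
  define C where "C = (2 * pi) ^ CARD('d)"
  have "C > 0" by (simp add: C_def)
  define z where "z a b \<beta> = fcoeff (\<lambda>\<theta>. Zt \<theta> a b) (idiff \<alpha> \<beta>)" for a b \<beta>
  define v where "v a b \<beta> = fcoeff (\<lambda>\<theta>. Vt \<theta> a b) (idiff \<alpha> \<beta>)" for a b \<beta>
  have sum_split: "(\<Sum>j\<in>UNIV. f j) = (\<Sum>b\<in>UNIV. f (Inl b)) + (\<Sum>b\<in>UNIV. f (Inr b))" for f :: "'a + 'a \<Rightarrow> complex"
    using sum.Plus[of "UNIV :: 'a set" "UNIV :: 'a set" f] by (simp add: UNIV_Plus_UNIV)
  have main: "(\<Sum>\<beta>\<in>Lambda n. \<Sum>b\<in>UNIV. qmult (z a b \<beta>, v a b \<beta>) (x (\<beta>, b))) = (C * r) *\<^sub>R x (\<alpha>, a)" for a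
  proof -
    have "(\<alpha>, a) \<in> toeplitz_index n" using \<alpha> by (simp add: toeplitz_index_def)
    from eig[OF this]
    have "(\<Sum>\<beta>\<in>Lambda n. \<Sum>b\<in>UNIV. qmult ((1 / C) *\<^sub>R (z a b \<beta>, v a b \<beta>)) (x (\<beta>, b))) = qmult (x (\<alpha>, a)) (qofreal r)"
      by (simp add: toeplitz_index_def sum.cartesian_product' toeplitz_entry C_def z_def v_def)
    moreover have "qmult ((1 / C) *\<^sub>R p) q = (1 / C) *\<^sub>R qmult p q" for p q
      by (simp add: qmult_def scaleR_conv_of_real prod_eq_iff algebra_simps)
    moreover have "qmult q (qofreal r) = r *\<^sub>R q" for q
      by (simp add: qmult_def qofreal_def scaleR_conv_of_real prod_eq_iff)
    ultimately have "(1 / C) *\<^sub>R (\<Sum>\<beta>\<in>Lambda n. \<Sum>b\<in>UNIV. qmult (z a b \<beta>, v a b \<beta>) (x (\<beta>, b))) = r *\<^sub>R x (\<alpha>, a)"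
      by (simp only: scaleR_sum_right)
    hence "C *\<^sub>R (1 / C) *\<^sub>R (\<Sum>\<beta>\<in>Lambda n. \<Sum>b\<in>UNIV. qmult (z a b \<beta>, v a b \<beta>) (x (\<beta>, b))) = C *\<^sub>R r *\<^sub>R x (\<alpha>, a)"
      by (rule arg_cong)
    thus ?thesis using \<open>C > 0\<close> by simp
  qed
  have main1: "(\<Sum>\<beta>\<in>Lambda n. \<Sum>b\<in>UNIV. z a b \<beta> * fst (x (\<beta>, b)) - v a b \<beta> * cnj (snd (x (\<beta>, b)))) = of_real (C * r) * fst (x (\<alpha>, a))" for a
    using arg_cong[OF main[of a], of fst] by (simp add: fst_sum qmult_def scaleR_conv_of_real)
  have main2: "(\<Sum>\<beta>\<in>Lambda n. \<Sum>b\<in>UNIV. z a b \<beta> * snd (x (\<beta>, b)) + v a b \<beta> * cnj (fst (x (\<beta>, b)))) = of_real (C * r) * snd (x (\<alpha>, a))" for a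
    using arg_cong[OF main[of a], of snd] by (simp add: snd_sum qmult_def scaleR_conv_of_real)
  show ?thesis
  proof (cases i)
    case (Inl a)
    have "(\<Sum>\<beta>\<in>Lambda n. \<Sum>j\<in>UNIV. fcoeff (\<lambda>\<theta>. G \<theta> i j) (idiff \<alpha> \<beta>) * y \<beta> j) =
        (\<Sum>\<beta>\<in>Lambda n. \<Sum>b\<in>UNIV. z a b \<beta> * fst (x (\<beta>, b)) - v a b \<beta> * cnj (snd (x (\<beta>, b))))"
      by (simp add: sum_split Inl fcoeff_G y_def z_def v_def sum_subtractf sum_negf)
    thus ?thesis using main1[of a] by (simp add: Inl y_def C_def)
  next
    case (Inr a)
    have "(\<Sum>\<beta>\<in>Lambda n. \<Sum>j\<in>UNIV. fcoeff (\<lambda>\<theta>. G \<theta> i j) (idiff \<alpha> \<beta>) * y \<beta> j) =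
        - cnj (\<Sum>\<beta>\<in>Lambda n. \<Sum>b\<in>UNIV. z a b \<beta> * snd (x (\<beta>, b)) + v a b \<beta> * cnj (fst (x (\<beta>, b))))"
      by (simp add: sum_split Inr fcoeff_G y_def z_def v_def sum.distrib sum_subtractf sum_negf)
    thus ?thesis unfolding main2 by (simp add: Inr y_def C_def)
  qed
qed

end

theorem mainTheorem14:
  fixes Z W :: "real^'d::finite \<Rightarrow> 'a::finite \<Rightarrow> 'a \<Rightarrow> complex"
    and SL :: "'d set"
  assumes L1Z: "\<And>a b. set_integrable lborel torus (\<lambda>\<theta>. Z \<theta> a b)"
    and L1W: "\<And>a b. set_integrable lborel torus (\<lambda>\<theta>. W \<theta> a b)"
    and herm: "\<And>n :: 'd \<Rightarrow> nat. (\<forall>j. 1 \<le> n j) \<Longrightarrow>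
                 qhermitian (toeplitz_index n) (toeplitz SL (quatF Z W))"
  shows "\<forall>n :: 'd \<Rightarrow> nat. (\<forall>j. 1 \<le> n j) \<longrightarrow>
           (\<forall>lam. qright_eigenvalue (toeplitz_index n) (toeplitz SL (quatF Z W)) lam \<longrightarrow>
              (\<exists>r. lam = qofreal r
                   \<and> essinf_torus (\<lambda>\<theta>. lambda_min (Gsym SL Z W \<theta>)) \<le> ereal r
                   \<and> ereal r \<le> esssup_torus (\<lambda>\<theta>. lambda_max (Gsym SL Z W \<theta>))))"
proof (intro allI impI)
  fix n :: "'d \<Rightarrow> nat" and lam
  assume n: "\<forall>j. 1 \<le> n j" and "qright_eigenvalue (toeplitz_index n) (toeplitz SL (quatF Z W)) lam"
  then obtain x where nz: "\<exists>p\<in>toeplitz_index n. x p \<noteq> 0"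
    and eig: "\<And>p. p \<in> toeplitz_index n \<Longrightarrow>
      (\<Sum>q\<in>toeplitz_index n. qmult (toeplitz SL (quatF Z W) p q) (x q)) = qmult (x p) lam"
    unfolding qright_eigenvalue_def by blast
  interpret toeplitz_symbol Z W SL by standard (rule L1Z L1W)+
  have "finite (toeplitz_index n :: (('d \<Rightarrow> nat) \<times> 'a) set)"
    by (simp add: toeplitz_index_def finite_Lambda)
  from qright_eigenvalue_hermitian_real[OF herm[OF n] this nz eig]
  obtain r where r: "lam = qofreal r" by blast
  define y where "y \<alpha> i = (case i of Inl a \<Rightarrow> fst (x (\<alpha>, a)) | Inr a \<Rightarrow> - cnj (snd (x (\<alpha>, a))))" for \<alpha> i
  have y_eig: "(\<Sum>\<beta>\<in>Lambda n. \<Sum>j\<in>UNIV. fcoeff (\<lambda>\<theta>. G \<theta> i j) (idiff \<alpha> \<beta>) * y \<beta> j) =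
    of_real ((2 * pi) ^ CARD('d) * r) * y \<alpha> i" if "\<alpha> \<in> Lambda n" for \<alpha> i
    unfolding y_def by (rule toeplitz_eigenvector[OF eig[unfolded r] that])
  have y_nz: "\<exists>\<alpha>\<in>Lambda n. \<exists>i. y \<alpha> i \<noteq> 0"
  proof -
    obtain \<alpha> a where p: "\<alpha> \<in> Lambda n" "x (\<alpha>, a) \<noteq> 0"
      using nz by (auto simp: toeplitz_index_def)
    hence "y \<alpha> (Inl a) \<noteq> 0 \<or> y \<alpha> (Inr a) \<noteq> 0" by (auto simp: y_def prod_eq_iff)
    thus ?thesis using p(1) by blast
  qed
  have supp: "AE \<theta> in lborel. \<theta> \<notin> torus \<longrightarrow> (\<forall>i j. G \<theta> i j = 0)"
    using AE_G by eventually_elim simp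
  have G_herm: "AE \<theta> in lborel. \<forall>i j. G \<theta> i j = cnj (G \<theta> j i)"
    by (rule AE_G_hermitian) (use herm in blast)
  have lower: "c \<le> r" if "AE \<theta> in lborel. \<theta> \<in> torus \<longrightarrow> ereal c \<le> lambda_min (Gsym SL Z W \<theta>)" for c
  proof (rule toeplitz_eigenvalue_lower_bound[OF integrable_G supp G_herm _ finite_Lambda y_nz y_eig])
    show "AE \<theta> in lborel. \<theta> \<in> torus \<longrightarrow> ereal c \<le> lambda_min (G \<theta>)"
      using that AE_G by eventually_elim simp
  qed
  have upper: "r \<le> c" if "AE \<theta> in lborel. \<theta> \<in> torus \<longrightarrow> lambda_max (Gsym SL Z W \<theta>) \<le> ereal c" for c
  proof -
    \<comment> \<open>Negation exchanges the ends of the spectrum: an almost everywhere upper bound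
      \<open>c\<close> for \<open>lambda_max\<close> is a lower bound \<open>- c\<close> for
      \<open>lambda_min\<close> of the negated symbol, whose Toeplitz matrix has the eigenvalue
      \<open>- r\<close> on the same vector.\<close>
    have "- c \<le> - r"
    proof (rule toeplitz_eigenvalue_lower_bound[where G = "\<lambda>\<theta> i j. - G \<theta> i j", OF _ _ _ _ finite_Lambda y_nz])
      show "AE \<theta> in lborel. \<theta> \<in> torus \<longrightarrow> ereal (- c) \<le> lambda_min (\<lambda>i j. - G \<theta> i j)"
        using that AE_G
      proof eventually_elim
        case (elim \<theta>)
        have "- c \<le> s" if "\<theta> \<in> torus" "s \<in> real_eigenvalues (\<lambda>i j. - G \<theta> i j)" for s
        proof -
          have "ereal (- s) \<le> lambda_max (G \<theta>)"
            using that(2) unfolding lambda_max_def real_eigenvalues_uminus by (intro Sup_upper imageI)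
          also have "\<dots> \<le> ereal c" using elim that(1) by simp
          finally show ?thesis by simp
        qed
        thus ?case unfolding lambda_min_def by (auto intro!: Inf_greatest)
      qed
      show "AE \<theta> in lborel. \<theta> \<notin> torus \<longrightarrow> (\<forall>i j. - G \<theta> i j = 0)"
        using supp by eventually_elim simp
      show "AE \<theta> in lborel. \<forall>i j. - G \<theta> i j = cnj (- G \<theta> j i)"
        using G_herm
      proof eventually_elim
        case (elim \<theta>)
        show ?case
        proof (intro allI)
          fix i j
          show "- G \<theta> i j = cnj (- G \<theta> j i)"
            unfolding complex_cnj_minus using elim[rule_format, of i j] by (rule arg_cong)
        qed
      qed
      show "(\<Sum>\<beta>\<in>Lambda n. \<Sum>j\<in>UNIV. fcoeff (\<lambda>\<theta>. - G \<theta> i j) (idiff \<alpha> \<beta>) * y \<beta> j) =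
          of_real ((2 * pi) ^ CARD('d) * - r) * y \<alpha> i" if "\<alpha> \<in> Lambda n" for \<alpha> i
        using y_eig[OF that, of i] by (simp add: fcoeff_uminus sum_negf)
    qed (simp add: integrable_G)
    thus ?thesis by simp
  qed
  have "essinf_torus (\<lambda>\<theta>. lambda_min (Gsym SL Z W \<theta>)) \<le> ereal r"
    unfolding essinf_torus_def
  proof (rule Sup_least, clarify)
    fix c :: ereal assume c: "AE \<theta> in lborel. \<theta> \<in> torus \<longrightarrow> c \<le> lambda_min (Gsym SL Z W \<theta>)"
    show "c \<le> ereal r"
    proof (cases c)
      case (real s)
      thus ?thesis using lower[of s] c by simp
    next
      case PInf
      \<comment> \<open>If infinity were an almost everywhere lower bound, every real number would
        be one too; \<open>r + 1\<close> already gives a contradiction. The case of minus infinity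
        further down is excluded likewise, with \<open>r - 1\<close>.\<close>
      hence "r + 1 \<le> r" using c by (intro lower) auto
      thus ?thesis by simp
    qed simp
  qed
  moreover have "ereal r \<le> esssup_torus (\<lambda>\<theta>. lambda_max (Gsym SL Z W \<theta>))"
    unfolding esssup_torus_def
  proof (rule Inf_greatest, clarify)
    fix c :: ereal assume c: "AE \<theta> in lborel. \<theta> \<in> torus \<longrightarrow> lambda_max (Gsym SL Z W \<theta>) \<le> c"
    show "ereal r \<le> c"
    proof (cases c)
      case (real s)
      thus ?thesis using upper[of s] c by simp
    next
      case MInf
      hence "r \<le> r - 1" using c by (intro upper) auto
      thus ?thesis by simp
    qed simp
  qed
  ultimately show "\<exists>r. lam = qofreal r
      \<and> essinf_torus (\<lambda>\<theta>. lambda_min (Gsym SL Z W \<theta>)) \<le> ereal r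
      \<and> ereal r \<le> esssup_torus (\<lambda>\<theta>. lambda_max (Gsym SL Z W \<theta>))"
    using r by blast
qed

end
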